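(* Let $\mathbb{K}$ be an algebraically closed field, let $\alpha,\beta,\gamma\in\mathbb{K}$, and let $q\in\mathbb{K}^*$ be such that $q^2$ is a primitive $l$-th root of unity with $l>1$. Then the PI degree of $A(\alpha,\beta,\gamma)$ equals $l$.
   Context: For $\alpha,\beta,\gamma\in\mathbb{K}$ and $q\in\mathbb{K}^*$, the 3-cyclic quantum Weyl algebra $A(\alpha,\beta,\gamma)$ is the associative unital $\mathbb{K}$-algebra generated by $x,y,z$ subject to the relations $xy=q^2yx+\alpha$, $xz=q^{-2}zx+\beta$, $yz=q^2zy+\gamma$. A ring $R$ is a PI ring if there is a monic polynomial $f\in\mathbb{Z}\langle x_1,\ldots,x_k\rangle$ in noncommuting variables (monic: some monomial of highest degree occurring in $f$ has coefficient $1$) with $f(r_1,\ldots,r_k)=0$ for all $r_i\in R$. The minimal degree $d$ of a PI ring is the least degree of all its monic polynomial identities. The PI degree of a prime PI ring of minimal degree $d$ is $d/2$. (Equivalently, by Posner's theorem, its square is the dimension, over its center, of the central simple algebra obtained by inverting the nonzero central elements.) *)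

theory Defs
  imports
    "HOL-Algebra.Algebraic_Closure_Type"
    "HOL-Algebra.QuotRing"
    "HOL-Library.Poly_Mapping"
begin

section \<open>Noncommutative polynomials\<close>

text \<open>
  Words are wrapped in a datatype so that concatenation can serve as the additive monoid
  operation on exponents expected by the monoid algebra construction of
  \<^theory>\<open>HOL-Library.Poly_Mapping\<close>.
\<close>

datatype 'a free_monoid = Word (letters: "'a list")

instantiation free_monoid :: (type) monoid_add
begin

definition zero_free_monoid :: "'a free_monoid"
  where "0 = Word []"

definition plus_free_monoid :: "'a free_monoid \<Rightarrow> 'a free_monoid \<Rightarrow> 'a free_monoid"
  where "u + v = Word (letters u @ letters v)"

instance
  by standard (simp_all add: zero_free_monoid_def plus_free_monoid_def)

end

text \<open>
  The multiplication that \<^theory>\<open>HOL-Library.Poly_Mapping\<close> puts on this type is the convolution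
  along concatenation of words, so it is the free associative unital algebra on the letters.
\<close>

type_synonym ('a, 'r) free_algebra = "'a free_monoid \<Rightarrow>\<^sub>0 'r"

definition nc_var :: "'a \<Rightarrow> ('a, 'r::semiring_1) free_algebra"
  where "nc_var x = Poly_Mapping.single (Word [x]) 1"

definition nc_const :: "'r \<Rightarrow> ('x, 'r::semiring_1) free_algebra"
  where "nc_const c = Poly_Mapping.single 0 c"


section \<open>The 3-cyclic quantum Weyl algebra\<close>

datatype xyz = Gen_x | Gen_y | Gen_z

definition cyclic_weyl_relators :: "'k \<Rightarrow> 'k \<Rightarrow> 'k \<Rightarrow> 'k \<Rightarrow> (xyz, 'k::field) free_algebra set"
  where "cyclic_weyl_relators q \<alpha> \<beta> \<gamma> =
    (let x = nc_var Gen_x; y = nc_var Gen_y; z = nc_var Gen_z in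
      {x * y - (nc_const (q\<^sup>2) * y * x + nc_const \<alpha>),
       x * z - (nc_const (inverse (q\<^sup>2)) * z * x + nc_const \<beta>),
       y * z - (nc_const (q\<^sup>2) * z * y + nc_const \<gamma>)})"

definition cyclic_weyl_algebra ::
    "'k \<Rightarrow> 'k \<Rightarrow> 'k \<Rightarrow> 'k \<Rightarrow> (xyz, 'k::field) free_algebra set ring"
  where "cyclic_weyl_algebra q \<alpha> \<beta> \<gamma> =
    (let F = ring_of_type_algebra in F Quot (Idl\<^bsub>F\<^esub> (cyclic_weyl_relators q \<alpha> \<beta> \<gamma>)))"

definition primitive_root_of_unity :: "nat \<Rightarrow> 'k::field \<Rightarrow> bool"
  where "primitive_root_of_unity l x \<longleftrightarrow> l > 0 \<and> x ^ l = 1 \<and> (\<forall>k. 0 < k \<and> k < l \<longrightarrow> x ^ k \<noteq> 1)"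


section \<open>Polynomial identities and PI degree\<close>

text \<open>
  The letters are drawn from \<^typ>\<open>nat\<close>, which is the union over all \<open>k\<close> of the free algebras in
  \<open>k\<close> variables: every element involves only finitely many letters, and the values of an
  assignment on the other letters play no role.
\<close>

type_synonym nc_int_poly = "(nat, int) free_algebra"

definition nc_eval :: "('a, 'm) ring_scheme \<Rightarrow> (nat \<Rightarrow> 'a) \<Rightarrow> nc_int_poly \<Rightarrow> 'a"
  where "nc_eval R r f =
    (\<Oplus>\<^bsub>R\<^esub>w\<in>Poly_Mapping.keys f.
      [Poly_Mapping.lookup f w] \<cdot>\<^bsub>R\<^esub> foldr (\<otimes>\<^bsub>R\<^esub>) (map r (letters w)) \<one>\<^bsub>R\<^esub>)"

definition nc_degree :: "nc_int_poly \<Rightarrow> nat"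
  where "nc_degree f = Max ((\<lambda>w. length (letters w)) ` Poly_Mapping.keys f)"

definition nc_monic :: "nc_int_poly \<Rightarrow> bool"
  where "nc_monic f \<longleftrightarrow>
    (\<exists>w\<in>Poly_Mapping.keys f. length (letters w) = nc_degree f \<and> Poly_Mapping.lookup f w = 1)"

definition monic_identity :: "('a, 'm) ring_scheme \<Rightarrow> nc_int_poly \<Rightarrow> bool"
  where "monic_identity R f \<longleftrightarrow>
    nc_monic f \<and> (\<forall>r. (\<forall>i. r i \<in> carrier R) \<longrightarrow> nc_eval R r f = \<zero>\<^bsub>R\<^esub>)"

definition PI_ring :: "('a, 'm) ring_scheme \<Rightarrow> bool"
  where "PI_ring R \<longleftrightarrow> ring R \<and> (\<exists>f. monic_identity R f)"

definition minimal_degree :: "('a, 'm) ring_scheme \<Rightarrow> nat"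
  where "minimal_degree R = (LEAST d. \<exists>f. monic_identity R f \<and> nc_degree f = d)"

definition prime_ring :: "('a, 'm) ring_scheme \<Rightarrow> bool"
  where "prime_ring R \<longleftrightarrow> ring R \<and> \<one>\<^bsub>R\<^esub> \<noteq> \<zero>\<^bsub>R\<^esub> \<and>
    (\<forall>a\<in>carrier R. \<forall>b\<in>carrier R.
      (\<forall>r\<in>carrier R. a \<otimes>\<^bsub>R\<^esub> r \<otimes>\<^bsub>R\<^esub> b = \<zero>\<^bsub>R\<^esub>) \<longrightarrow> a = \<zero>\<^bsub>R\<^esub> \<or> b = \<zero>\<^bsub>R\<^esub>)"

text \<open>Only meaningful when \<^term>\<open>prime_ring R\<close> and \<^term>\<open>PI_ring R\<close> hold.\<close>

definition PI_degree :: "('a, 'm) ring_scheme \<Rightarrow> rat"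
  where "PI_degree R = of_nat (minimal_degree R) / 2"

end

theory Submission
  imports Defs "Jordan_Normal_Form.Determinant" "HOL-Computational_Algebra.Formal_Laurent_Series"
    "HOL-Combinatorics.Multiset_Permutations"
begin

text \<open>
  Put \<open>p = q\<^sup>2\<close>.  Every triple of scalars \<open>u \<noteq> 0\<close>, \<open>v \<noteq> 0\<close>, \<open>\<omega>\<close> in an extension field gives a
  representation of the algebra by \<open>l \<times> l\<close> matrices whose image spans the full matrix algebra,
  because it contains a diagonal matrix with distinct eigenvalues and a cyclic shift.

  Over \<open>K\<close> itself such a representation is onto, so every monic identity of the algebra holds for
  \<open>l \<times> l\<close> matrices and has degree at least \<open>2 l\<close>.  Over formal Laurent series, with \<open>u\<close>, \<open>v\<close>, \<open>\<omega>\<close>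
  powers of the variable of quickly growing degree, the images of the monomials \<open>z\<^sup>i y\<^sup>j x\<^sup>k\<close> have
  different degrees, so no nonzero element of the algebra is killed by all these representations.
  Hence the algebra inherits primeness from matrix algebras, and it satisfies the standard identity
  of degree \<open>2 l\<close> by the Amitsur-Levitzki theorem.  The latter is proved with Rosset's argument:
  for \<open>\<Theta> = \<Sum> A\<^sub>k e\<^sub>k\<close> over an exterior algebra, \<open>\<Theta>\<^sup>2\<close> has entries in a commutative ring and all its
  powers have trace \<open>0\<close>, so \<open>\<Theta>\<^sup>2\<^sup>n = 0\<close>.
\<close>

section \<open>Matrices all of whose powers have trace zero\<close>

text \<open>Onto and faithful cannot be had together: a representation over \<open>K\<close> maps an
  infinite-dimensional algebra to finite matrices and so has a kernel, while over Laurent series the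
  image is only a \<open>K\<close>-subalgebra whose linear span is everything. Even there no single
  representation is claimed to be injective: degrees separate the ordered monomials only below a
  bound \<open>D\<close> on the exponents of \<open>y\<close> and \<open>x\<close>, so
  \<open>D\<close> is chosen after the elements under discussion. The trace argument divides by
  positive integers, which may vanish in \<open>K\<close>. It is therefore run for integer matrices,
  and multilinearity of the standard polynomial carries the result to every commutative ring. The
  nilpotency criterion avoids eigenvalues because the even part of an exterior algebra is not a
  domain; power series and determinants over a commutative ring replace them.\<close>

lemma fps_deriv_prod_split:
  fixes f :: "'i \<Rightarrow> 'a::comm_ring_1 fps"
  assumes "finite S"
  shows "fps_deriv (\<Prod>i\<in>S. f i) = (\<Sum>k\<in>S. \<Prod>i\<in>S. if i = k then fps_deriv (f i) else f i)"
  using assms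
proof (induction S rule: finite_induct)
  case (insert x S)
  have "(\<Prod>i\<in>insert x S. if i = k then fps_deriv (f i) else f i)
      = f x * (\<Prod>i\<in>S. if i = k then fps_deriv (f i) else f i)" if "k \<in> S" for k
    using insert that by auto
  moreover have "(\<Prod>i\<in>S. if i = x then fps_deriv (f i) else f i) = (\<Prod>i\<in>S. f i)"
    using insert by (intro prod.cong) auto
  ultimately show ?case
    using insert by (simp add: sum_distrib_left add.commute)
qed simp

text \<open>Jacobi's formula. The determinant is linear in each row, so the derivative acts on one
  row at a time; along the differentiated row the cofactors are still those of
  \<open>A\<close>.\<close>

lemma fps_deriv_det:
  fixes A :: "'a::comm_ring_1 fps mat"
  assumes A: "A \<in> carrier_mat n n"
  shows "fps_deriv (det A) = (\<Sum>k<n. \<Sum>j<n. fps_deriv (A $$ (k, j)) * cofactor A k j)"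
proof -
  define R where "R k = mat n n (\<lambda>(i, j). if i = k then fps_deriv (A $$ (i, j)) else A $$ (i, j))" for k
  have R: "R k \<in> carrier_mat n n" for k
    by (simp add: R_def)
  have "fps_deriv (det A) = (\<Sum>p | p permutes {0..<n}.
      of_int (sign p) * fps_deriv (\<Prod>i = 0..<n. A $$ (i, p i)))"
    unfolding det_def'[OF A] fps_deriv_sum
    by (intro sum.cong refl, case_tac x rule: sign_cases) auto
  also have "\<dots> = (\<Sum>p | p permutes {0..<n}. \<Sum>k = 0..<n. 
      of_int (sign p) * (\<Prod>i = 0..<n. R k $$ (i, p i)))"
    unfolding fps_deriv_prod_split[OF finite_atLeastLessThan] sum_distrib_left
    by (intro sum.cong refl arg_cong2[of _ _ _ _ "(*)"] prod.cong)
       (auto simp: R_def dest: permutes_in_image)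
  also have "\<dots> = (\<Sum>k<n. det (R k))"
    by (subst sum.swap) (simp add: det_def'[OF R] atLeast0LessThan)
  also have "det (R k) = (\<Sum>j<n. fps_deriv (A $$ (k, j)) * cofactor A k j)" if "k < n" for k
  proof -
    have "det (R k) = (\<Sum>j<n. R k $$ (k, j) * cofactor (R k) k j)"
      by (rule laplace_expansion_row[OF R that])
    also have "cofactor (R k) k j = cofactor A k j" if "j < n" for j
    proof -
      have "mat_delete (R k) k j = mat_delete A k j"
        using A that \<open>k < n\<close> by (intro eq_matI) (auto simp: mat_delete_def R_def)
      then show ?thesis by (simp add: cofactor_def)
    qed
    hence "(\<Sum>j<n. R k $$ (k, j) * cofactor (R k) k j)
        = (\<Sum>j<n. fps_deriv (A $$ (k, j)) * cofactor A k j)"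
      using that by (intro sum.cong) (auto simp: R_def)
    finally show ?thesis .
  qed
  hence "(\<Sum>k<n. det (R k)) = (\<Sum>k<n. \<Sum>j<n. fps_deriv (A $$ (k, j)) * cofactor A k j)"
    by (intro sum.cong) auto
  finally show ?thesis .
qed

lemma fps_nth_prod_linear_eq_0:
  fixes f :: "'i \<Rightarrow> 'a::comm_ring_1 fps"
  assumes "finite S" "\<And>x k. x \<in> S \<Longrightarrow> k > 1 \<Longrightarrow> f x $ k = 0" "k > card S"
  shows "(\<Prod>x\<in>S. f x) $ k = 0"
  using assms
proof (induction S arbitrary: k rule: finite_induct)
  case (insert x S)
  have "f x $ i * prod f S $ (k - i) = 0" if "i \<le> k" for i
  proof (cases "i > 1")
    case False
    then have "k - i > card S" using insert by auto
    then show ?thesis using insert by auto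
  qed (use insert in auto)
  then show ?case using insert by (simp add: fps_mult_nth)
qed auto

text \<open>The Leibniz formula turns this into a degree count: a product of n entries that are
  linear in the series variable has degree at most n.\<close>

lemma fps_nth_det_linear_eq_0:
  fixes A :: "'a::comm_ring_1 fps mat"
  assumes A: "A \<in> carrier_mat n n"
    and "\<And>i j k. i < n \<Longrightarrow> j < n \<Longrightarrow> k > 1 \<Longrightarrow> A $$ (i, j) $ k = 0" and "k > n"
  shows "det A $ k = 0"
proof -
  have "(\<Prod>i = 0..<n. A $$ (i, p i)) $ k = 0" if "p permutes {0..<n}" for p
    using assms that by (intro fps_nth_prod_linear_eq_0) (auto dest: permutes_in_image)
  then show ?thesis
    unfolding det_def'[OF A] fps_sum_nth
    by (intro sum.neutral ballI, case_tac x rule: sign_cases) auto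
qed

text \<open>
  The inverse of \<open>1 - t B\<close> over power series is \<open>\<Sum> t\<^sup>k B\<^sup>k\<close>, and the logarithmic derivative of
  \<open>det (1 - t B)\<close> is \<open>- \<Sum> t\<^sup>k tr B\<^sup>k\<^sup>+\<^sup>1\<close>.  So here the determinant is constant, and
  \<open>\<Sum> t\<^sup>k B\<^sup>k\<close> is up to a unit the adjugate of \<open>1 - t B\<close>, whose degree in \<open>t\<close> is less than \<open>n\<close>.
\<close>

lemma pow_mat_eq_0_of_traces:
  fixes B :: "'a::comm_ring_1 mat"
  assumes B: "B \<in> carrier_mat n n"
    and tr: "\<And>k. k > 0 \<Longrightarrow> (\<Sum>i<n. (B ^\<^sub>m k) $$ (i, i)) = 0"
    and torsion_free: "\<And>m x. m > 0 \<Longrightarrow> of_nat m * x = (0::'a) \<Longrightarrow> x = 0"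
  shows "B ^\<^sub>m n = 0\<^sub>m n n"
proof (cases "n = 0")
  case True
  then show ?thesis using B by (intro eq_matI) auto
next
  case n: False
  define M where "M = mat n n (\<lambda>(i, j). fps_const (if i = j then 1 else 0) - fps_X * fps_const (B $$ (i, j)))"
  define G where "G = mat n n (\<lambda>(i, j). Abs_fps (\<lambda>k. (B ^\<^sub>m k) $$ (i, j)))"
  have M: "M \<in> carrier_mat n n" and G: "G \<in> carrier_mat n n" by (auto simp: M_def G_def)
  note adj = adj_mat[OF M]
  have pw: "B ^\<^sub>m k \<in> carrier_mat n n" for k using B by simp
  have pwS: "(\<Sum>k<n. (B ^\<^sub>m m) $$ (i, k) * B $$ (k, j)) = (B ^\<^sub>m Suc m) $$ (i, j)" if "i < n" "j < n" for i j m
    using that B pw[of m] by (simp add: scalar_prod_def atLeast0LessThan)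
  have GM: "G * M = 1\<^sub>m n"
  proof (rule eq_matI)
    fix i j assume "i < dim_row (1\<^sub>m n :: 'a fps mat)" "j < dim_col (1\<^sub>m n :: 'a fps mat)"
    then have ij: "i < n" "j < n" by auto
    have "(G * M) $$ (i, j) = (\<Sum>k<n. G $$ (i, k) * M $$ (k, j))"
      using ij G M by (simp add: scalar_prod_def atLeast0LessThan)
    also have "\<dots> = (\<Sum>k<n. (if k = j then G $$ (i, k) else 0) - fps_X * (G $$ (i, k) * fps_const (B $$ (k, j))))"
      using ij by (intro sum.cong refl) (auto simp: M_def algebra_simps)
    also have "\<dots> = G $$ (i, j) - fps_X * (\<Sum>k<n. G $$ (i, k) * fps_const (B $$ (k, j)))"
      using ij by (simp add: sum_subtractf sum_distrib_left)
    also have "(\<Sum>k<n. G $$ (i, k) * fps_const (B $$ (k, j))) = Abs_fps (\<lambda>m. (B ^\<^sub>m Suc m) $$ (i, j))"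
      unfolding fps_eq_iff by (auto simp: fps_sum_nth G_def pwS[symmetric] ij simp del: pow_mat.simps)
    also have "G $$ (i, j) - fps_X * \<dots> = 1\<^sub>m n $$ (i, j)"
      unfolding fps_eq_iff using ij B by (auto simp: G_def gr0_conv_Suc)
    finally show "(G * M) $$ (i, j) = 1\<^sub>m n $$ (i, j)" .
  qed (use G M in auto)
  have adj_eq: "adj_mat M = det M \<cdot>\<^sub>m G"
  proof -
    have "adj_mat M = (G * M) * adj_mat M" using adj by (simp add: GM)
    also have "\<dots> = G * (M * adj_mat M)" using G M adj by (intro assoc_mult_mat)
    also have "\<dots> = det M \<cdot>\<^sub>m G" using G by (simp add: adj mult_smult_distrib[of _ n n _ n])
    finally show ?thesis .
  qed
  have cof: "cofactor M k j = det M * G $$ (j, k)" if "k < n" "j < n" for k j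
  proof -
    have "cofactor M k j = adj_mat M $$ (j, k)" using that M by (simp add: adj_mat_def)
    then show ?thesis using that G by (simp add: adj_eq)
  qed
  \<comment> \<open>Jacobi's formula, with each cofactor replaced by \<open>det M\<close> times an
    entry of \<open>G\<close>, collects the traces of all positive powers of
    \<open>B\<close>.\<close>
  have "fps_deriv (det M) = (\<Sum>k<n. \<Sum>j<n. fps_const (- B $$ (k, j)) * (det M * G $$ (j, k)))"
    unfolding fps_deriv_det[OF M] by (intro sum.cong refl) (simp add: cof, simp add: M_def)
  also have "\<dots> = - det M * (\<Sum>j<n. \<Sum>k<n. G $$ (j, k) * fps_const (B $$ (k, j)))"
    by (subst sum.swap) (simp add: sum_distrib_left sum_negf algebra_simps flip: fps_const_neg)
  also have "(\<Sum>j<n. \<Sum>k<n. G $$ (j, k) * fps_const (B $$ (k, j))) = 0"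
    unfolding fps_eq_iff
    using tr[of "Suc m" for m]
    by (auto simp: fps_sum_nth G_def pwS simp del: pow_mat.simps)
  finally have "fps_deriv (det M) = 0" by simp
  \<comment> \<open>Coefficient k - 1 of the derivative is k times coefficient k of
    \<open>det M\<close>; torsion-freeness stands in for division by k.\<close>
  then have d0: "det M $ k = 0" if "k > 0" for k
    using torsion_free[of k "det M $ k"] that
    by (cases k) (auto simp: fps_eq_iff simp del: of_nat_Suc)
  have "det G * det M = 1" using det_mult[OF G M] GM by simp
  then have unit: "det G $ 0 * det M $ 0 = 1" by (metis fps_mult_nth_0 fps_one_nth)
  show ?thesis
  proof (rule eq_matI)
    fix i j assume "i < dim_row (0\<^sub>m n n :: 'a mat)" "j < dim_col (0\<^sub>m n n :: 'a mat)"
    then have ij: "i < n" "j < n" by auto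
    \<comment> \<open>The minor has size n - 1, so its degree stays below n, whereas coefficient n
      of \<open>G\<close> is the power in question.\<close>
    have "det (mat_delete M j i) $ n = 0"
      using ij M n by (intro fps_nth_det_linear_eq_0[of _ "n - 1"] mat_delete_carrier) 
        (auto simp: mat_delete_def M_def)
    then have "cofactor M j i $ n = 0" by (cases "even (j + i)") (auto simp: cofactor_def)
    then have "(det M * G $$ (i, j)) $ n = 0" using ij by (simp add: cof)
    moreover have "(det M * G $$ (i, j)) $ n = (\<Sum>k\<in>{0}. det M $ k * G $$ (i, j) $ (n - k))"
      unfolding fps_mult_nth by (intro sum.mono_neutral_right) (auto simp: d0)
    ultimately have "det M $ 0 * (B ^\<^sub>m n) $$ (i, j) = 0" using ij by (simp add: G_def)
    then have "(B ^\<^sub>m n) $$ (i, j) = 0" using unit by (metis mult.assoc mult_1 mult_zero_right)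
    then show "(B ^\<^sub>m n) $$ (i, j) = 0\<^sub>m n n $$ (i, j)" using ij by simp
  qed (use pw[of n] in auto)
qed

section \<open>The Amitsur-Levitzki theorem\<close>

text \<open>The sign of the permutation that sorts the concatenation of \<open>S\<close> and \<open>T\<close>, each listed increasingly.\<close>

definition inv_sign :: "nat set \<Rightarrow> nat set \<Rightarrow> int"
  where "inv_sign S T = (-1) ^ card {(s, t). s \<in> S \<and> t \<in> T \<and> t < s}"

lemma finite_inversions: "finite S \<Longrightarrow> finite T \<Longrightarrow> finite {(s, t). s \<in> S \<and> t \<in> T \<and> R t s}"
  by (rule finite_subset[of _ "S \<times> T"]) auto

lemma inv_sign_empty [simp]: "inv_sign {} T = 1" "inv_sign S {} = 1"
  by (simp_all add: inv_sign_def)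

text \<open>With its mirror image for the right argument, this gives the cocycle property behind
  associativity of the exterior product.\<close>

lemma inv_sign_Un_left:
  assumes "finite S" "finite S'" "finite T" "S \<inter> S' = {}"
  shows "inv_sign (S \<union> S') T = inv_sign S T * inv_sign S' T"
proof -
  have "{(s, t). s \<in> S \<union> S' \<and> t \<in> T \<and> t < s} =
      {(s, t). s \<in> S \<and> t \<in> T \<and> t < s} \<union> {(s, t). s \<in> S' \<and> t \<in> T \<and> t < s}" by auto
  then have "card {(s, t). s \<in> S \<union> S' \<and> t \<in> T \<and> t < s} =
      card {(s, t). s \<in> S \<and> t \<in> T \<and> t < s} + card {(s, t). s \<in> S' \<and> t \<in> T \<and> t < s}"
    using assms by (simp only:) (intro card_Un_disjoint finite_inversions, auto)
  then show ?thesis by (simp only: inv_sign_def power_add)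
qed

lemma inv_sign_Un_right:
  assumes "finite S" "finite T" "finite T'" "T \<inter> T' = {}"
  shows "inv_sign S (T \<union> T') = inv_sign S T * inv_sign S T'"
proof -
  have "{(s, t). s \<in> S \<and> t \<in> T \<union> T' \<and> t < s} =
      {(s, t). s \<in> S \<and> t \<in> T \<and> t < s} \<union> {(s, t). s \<in> S \<and> t \<in> T' \<and> t < s}" by auto
  then have "card {(s, t). s \<in> S \<and> t \<in> T \<union> T' \<and> t < s} =
      card {(s, t). s \<in> S \<and> t \<in> T \<and> t < s} + card {(s, t). s \<in> S \<and> t \<in> T' \<and> t < s}"
    using assms by (simp only:) (intro card_Un_disjoint finite_inversions, auto)
  then show ?thesis by (simp only: inv_sign_def power_add)
qed

text \<open>Each pair in \<open>S \<times> T\<close> is an inversion in exactly one of the two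
  orders.\<close>

lemma inv_sign_swap:
  assumes "finite S" "finite T" "S \<inter> T = {}"
  shows "inv_sign S T = (-1) ^ (card S * card T) * inv_sign T S"
proof -
  let ?A = "{(s, t). s \<in> S \<and> t \<in> T \<and> t < s}" and ?B = "{(s, t). s \<in> S \<and> t \<in> T \<and> s < t}"
  have "S \<times> T = ?A \<union> ?B" using assms by (auto simp: nat_neq_iff)
  then have "card S * card T = card (?A \<union> ?B)" by (metis card_cartesian_product)
  also have "\<dots> = card ?A + card ?B" using assms by (intro card_Un_disjoint finite_inversions) auto
  also have "card ?B = card {(s, t). s \<in> T \<and> t \<in> S \<and> t < s}"
    by (rule bij_betw_same_card[of prod.swap]) (auto simp: bij_betw_def inj_on_def)
  finally show ?thesis by (simp add: inv_sign_def power_add mult.assoc)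
qed

text \<open>
  The exterior algebra over the integers on generators indexed by \<^typ>\<open>nat\<close>, completed: the basis
  monomials are the finite sets of indices, and there is no bound on the support.
\<close>

typedef ext_alg = "{f :: nat set \<Rightarrow> int. \<forall>S. infinite S \<longrightarrow> f S = 0}"
  morphisms ext_coeff Abs_ext_alg
  by auto

setup_lifting type_definition_ext_alg

lemma ext_coeff_infinite: "infinite S \<Longrightarrow> ext_coeff f S = 0"
  by transfer auto

instantiation ext_alg :: ring_1
begin

lift_definition zero_ext_alg :: ext_alg is "\<lambda>_. 0" by simp
lift_definition one_ext_alg :: ext_alg is "\<lambda>S. if S = {} then 1 else 0" by auto
lift_definition plus_ext_alg :: "ext_alg \<Rightarrow> ext_alg \<Rightarrow> ext_alg" is "\<lambda>f g S. f S + g S" by simp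
lift_definition minus_ext_alg :: "ext_alg \<Rightarrow> ext_alg \<Rightarrow> ext_alg" is "\<lambda>f g S. f S - g S" by simp
lift_definition uminus_ext_alg :: "ext_alg \<Rightarrow> ext_alg" is "\<lambda>f S. - f S" by simp
text \<open>For infinite \<open>S\<close> the index set \<open>Pow S\<close> is infinite and the sum
  is 0 by convention, which keeps the product inside the type.\<close>

lift_definition times_ext_alg :: "ext_alg \<Rightarrow> ext_alg \<Rightarrow> ext_alg" is
  "\<lambda>f g S. \<Sum>T\<in>Pow S. inv_sign T (S - T) * f T * g (S - T)"
  by simp

instance
proof
  fix f g h :: ext_alg
  show "f * g * h = f * (g * h)"
  proof transfer
    fix f g h :: "nat set \<Rightarrow> int"
    show "(\<lambda>S. \<Sum>V\<in>Pow S. inv_sign V (S - V) * (\<Sum>T\<in>Pow V. inv_sign T (V - T) * f T * g (V - T)) * h (S - V))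
        = (\<lambda>S. \<Sum>T\<in>Pow S. inv_sign T (S - T) * f T * (\<Sum>U\<in>Pow (S - T). inv_sign U (S - T - U) * g U * h (S - T - U)))"
    proof (rule ext)
      fix S :: "nat set"
      show "(\<Sum>V\<in>Pow S. inv_sign V (S - V) * (\<Sum>T\<in>Pow V. inv_sign T (V - T) * f T * g (V - T)) * h (S - V))
        = (\<Sum>T\<in>Pow S. inv_sign T (S - T) * f T * (\<Sum>U\<in>Pow (S - T). inv_sign U (S - T - U) * g U * h (S - T - U)))"
      proof (cases "finite S")
        case True
        have fin: "finite V" if "V \<subseteq> S" for V using that True finite_subset by blast
        have "(\<Sum>V\<in>Pow S. inv_sign V (S - V) * (\<Sum>T\<in>Pow V. inv_sign T (V - T) * f T * g (V - T)) * h (S - V))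
          = (\<Sum>(V, T)\<in>Sigma (Pow S) Pow. inv_sign V (S - V) * inv_sign T (V - T) * f T * g (V - T) * h (S - V))"
          unfolding sum_distrib_left sum_distrib_right
          by (subst sum.Sigma) (auto simp: True fin mult.assoc)
        also have "\<dots> = (\<Sum>(T, U)\<in>Sigma (Pow S) (\<lambda>T. Pow (S - T)).
            inv_sign T (S - T) * f T * (inv_sign U (S - T - U) * g U * h (S - T - U)))"
        \<comment> \<open>A chain \<open>T \<subseteq> V \<subseteq> S\<close> is the same as
          disjoint \<open>T\<close> and \<open>U = V - T\<close> inside \<open>S\<close>; both sign
          products count the inversions between the three blocks \<open>T\<close>,
          \<open>V - T\<close>, \<open>S - V\<close>.\<close>
        proof (rule sum.reindex_bij_witness[of _ "\<lambda>(T, U). (T \<union> U, T)" "\<lambda>(V, T). (T, V - T)"], goal_cases)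
          case (5 p)
          obtain V T where p: "p = (V, T)" "V \<subseteq> S" "T \<subseteq> V" using 5 by auto
          have V: "V = T \<union> (V - T)" and ST: "S - T = (V - T) \<union> (S - V)" and W: "S - T - (V - T) = S - V"
            using p by auto
          have "inv_sign V (S - V) = inv_sign T (S - V) * inv_sign (V - T) (S - V)"
            by (subst V, rule inv_sign_Un_left) (use p fin True finite_subset in auto)
          moreover have "inv_sign T (S - T) = inv_sign T (V - T) * inv_sign T (S - V)"
            unfolding ST by (rule inv_sign_Un_right) (use p fin True finite_subset in auto)
          ultimately show ?case using p by (simp add: W)
        qed auto
        also have "\<dots> = (\<Sum>T\<in>Pow S. inv_sign T (S - T) * f T * (\<Sum>U\<in>Pow (S - T). inv_sign U (S - T - U) * g U * h (S - T - U)))"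
          unfolding sum_distrib_left by (subst sum.Sigma) (auto simp: True)
        finally show ?thesis .
      qed simp
    qed
  qed
  show "1 * f = f"
  proof transfer
    fix f :: "nat set \<Rightarrow> int" assume f: "\<forall>S. infinite S \<longrightarrow> f S = 0"
    have "(\<Sum>T\<in>Pow S. inv_sign T (S - T) * (if T = {} then 1 else 0) * f (S - T)) = f S" for S
    proof (cases "finite S")
      case True
      have "(\<Sum>T\<in>Pow S. inv_sign T (S - T) * (if T = {} then 1 else 0) * f (S - T)) =
        (\<Sum>T\<in>{{}}. inv_sign T (S - T) * (if T = {} then 1 else 0) * f (S - T))"
        using True by (intro sum.mono_neutral_right) auto
      then show ?thesis by simp
    qed (simp add: f)
    then show "(\<lambda>S. \<Sum>T\<in>Pow S. inv_sign T (S - T) * (if T = {} then 1 else 0) * f (S - T)) = f" ..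
  qed
  show "f * 1 = f"
  proof transfer
    fix f :: "nat set \<Rightarrow> int" assume f: "\<forall>S. infinite S \<longrightarrow> f S = 0"
    have "(\<Sum>T\<in>Pow S. inv_sign T (S - T) * f T * (if S - T = {} then 1 else 0)) = f S" for S
    proof (cases "finite S")
      case True
      have "(\<Sum>T\<in>Pow S. inv_sign T (S - T) * f T * (if S - T = {} then 1 else 0)) =
        (\<Sum>T\<in>{S}. inv_sign T (S - T) * f T * (if S - T = {} then 1 else 0))"
        using True by (intro sum.mono_neutral_right) auto
      then show ?thesis by simp
    qed (simp add: f)
    then show "(\<lambda>S. \<Sum>T\<in>Pow S. inv_sign T (S - T) * f T * (if S - T = {} then 1 else 0)) = f" ..
  qed
  show "(0::ext_alg) \<noteq> 1" by transfer (metis zero_neq_one)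
qed (transfer, auto simp: algebra_simps sum.distrib)+

end

lemmas ext_coeff_simps = zero_ext_alg.rep_eq plus_ext_alg.rep_eq minus_ext_alg.rep_eq
  uminus_ext_alg.rep_eq one_ext_alg.rep_eq

lemma ext_coeff_sum: "ext_coeff (\<Sum>x\<in>A. f x) S = (\<Sum>x\<in>A. ext_coeff (f x) S)"
  by (induction A rule: infinite_finite_induct) (auto simp: ext_coeff_simps)

text \<open>With \<open>\<epsilon> = 0\<close> for the even and \<open>\<epsilon> = 1\<close> for the odd part of the grading.\<close>

definition ext_parity :: "nat \<Rightarrow> ext_alg \<Rightarrow> bool"
  where "ext_parity \<epsilon> f \<longleftrightarrow> (\<forall>S. ext_coeff f S \<noteq> 0 \<longrightarrow> even (card S + \<epsilon>))"

lemma ext_parity_sum: "(\<And>x. x \<in> A \<Longrightarrow> ext_parity \<epsilon> (f x)) \<Longrightarrow> ext_parity \<epsilon> (\<Sum>x\<in>A. f x)"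
  unfolding ext_parity_def ext_coeff_sum by (meson sum.neutral)

lemma ext_parity_mult:
  assumes "ext_parity \<delta> f" "ext_parity \<epsilon> g"
  shows "ext_parity (\<delta> + \<epsilon>) (f * g)"
  unfolding ext_parity_def
proof (intro allI impI)
  fix S assume nz: "ext_coeff (f * g) S \<noteq> 0"
  then have fin: "finite S" using ext_coeff_infinite by blast
  from nz obtain T where T: "T \<subseteq> S" "ext_coeff f T \<noteq> 0" "ext_coeff g (S - T) \<noteq> 0"
    unfolding times_ext_alg.rep_eq by (auto elim!: sum.not_neutral_contains_not_neutral)
  then have "card S = card T + card (S - T)"
    using fin by (metis Diff_cancel card_Diff_subset card_mono finite_subset le_add_diff_inverse)
  then show "even (card S + (\<delta> + \<epsilon>))" using T assms unfolding ext_parity_def by fastforce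
qed

text \<open>Graded commutativity: exchanging a monomial with its complement costs a sign that
  depends only on the parities of the two degrees.\<close>

lemma ext_parity_commute:
  assumes "ext_parity \<delta> f" "ext_parity \<epsilon> g"
  shows "f * g = (-1) ^ (\<delta> * \<epsilon>) * (g * f)"
proof -
  have *: "ext_coeff (f * g) S = (-1) ^ (\<delta> * \<epsilon>) * ext_coeff (g * f) S" for S
  proof (cases "finite S")
    case True
    have sw: "inv_sign T (S - T) * ext_coeff f T * ext_coeff g (S - T) =
       (-1) ^ (\<delta> * \<epsilon>) * (inv_sign (S - T) T * ext_coeff g (S - T) * ext_coeff f T)" if "T \<subseteq> S" for T
    proof (cases "ext_coeff f T = 0 \<or> ext_coeff g (S - T) = 0")
      case False
      then have "even (card T + \<delta>)" "even (card (S - T) + \<epsilon>)"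
        using assms by (auto simp: ext_parity_def)
      then have "even (card T * card (S - T)) \<longleftrightarrow> even (\<delta> * \<epsilon>)" by simp
      then have "(-1::int) ^ (card T * card (S - T)) = (-1) ^ (\<delta> * \<epsilon>)" by (metis neg_one_even_power neg_one_odd_power)
      then show ?thesis
        using inv_sign_swap[of T "S - T"] that True finite_subset[OF that] by simp
    qed auto
    show ?thesis
      unfolding times_ext_alg.rep_eq sum_distrib_left
    proof (intro sum.reindex_bij_witness[of _ "\<lambda>T. S - T" "\<lambda>T. S - T"], goal_cases)
      case (5 T)
      then have "S - (S - T) = T" by auto
      then show ?case using sw[of T] 5 by auto
    qed auto
  qed (simp add: ext_coeff_infinite)
  then have "ext_coeff (f * g) = ext_coeff ((-1) ^ (\<delta> * \<epsilon>) * (g * f))"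
    by (cases "even (\<delta> * \<epsilon>)") (auto simp: fun_eq_iff ext_coeff_simps simp del: even_mult_iff)
  then show ?thesis by (simp add: ext_coeff_inject)
qed

text \<open>The even part gets a type of its own because determinants and adjugates need a
  commutative coefficient ring.\<close>

typedef even_ext_alg = "{f. ext_parity 0 f}"
  morphisms ext_of_even even_of_ext
  by (intro exI[of _ 0]) (simp add: ext_parity_def ext_coeff_simps)

setup_lifting type_definition_even_ext_alg

instantiation even_ext_alg :: comm_ring_1
begin

lift_definition zero_even_ext_alg :: even_ext_alg is 0 by (simp add: ext_parity_def ext_coeff_simps)
lift_definition one_even_ext_alg :: even_ext_alg is 1 by (simp add: ext_parity_def ext_coeff_simps)
lift_definition plus_even_ext_alg :: "even_ext_alg \<Rightarrow> even_ext_alg \<Rightarrow> even_ext_alg" is "(+)"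
  unfolding ext_parity_def ext_coeff_simps by (metis add_0)
lift_definition minus_even_ext_alg :: "even_ext_alg \<Rightarrow> even_ext_alg \<Rightarrow> even_ext_alg" is "(-)"
  unfolding ext_parity_def ext_coeff_simps by (metis diff_0_right)
lift_definition uminus_even_ext_alg :: "even_ext_alg \<Rightarrow> even_ext_alg" is uminus
  unfolding ext_parity_def ext_coeff_simps by simp
lift_definition times_even_ext_alg :: "even_ext_alg \<Rightarrow> even_ext_alg \<Rightarrow> even_ext_alg" is "(*)"
  using ext_parity_mult[of 0 _ 0] by simp

instance
proof
  fix f g :: even_ext_alg
  show "f * g = g * f" by transfer (use ext_parity_commute[of 0 _ 0] in simp)
qed (transfer, simp add: algebra_simps)+

end

lemma ext_of_even_sum: "ext_of_even (\<Sum>x\<in>A. f x) = (\<Sum>x\<in>A. ext_of_even (f x))"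
  by (induction A rule: infinite_finite_induct) (auto simp: zero_even_ext_alg.rep_eq plus_even_ext_alg.rep_eq)

lemma ext_coeff_of_nat_mult: "ext_coeff (of_nat m * f) S = int m * ext_coeff f S"
  by (induction m) (auto simp: ext_coeff_simps algebra_simps)

lemma even_ext_alg_torsion_free:
  fixes x :: even_ext_alg
  assumes "m > 0" "of_nat m * x = 0"
  shows "x = 0"
proof -
  have "ext_of_even (of_nat m) = of_nat m"
    by (induction m) (auto simp: zero_even_ext_alg.rep_eq one_even_ext_alg.rep_eq plus_even_ext_alg.rep_eq)
  with assms(2) have "of_nat m * ext_of_even x = 0"
    by (metis times_even_ext_alg.rep_eq zero_even_ext_alg.rep_eq)
  then have "ext_coeff (ext_of_even x) S = 0" for S
    using assms(1) ext_coeff_of_nat_mult[of m "ext_of_even x" S] by (simp add: ext_coeff_simps)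
  then have "ext_of_even x = 0" by (simp add: ext_coeff_inject[symmetric] fun_eq_iff ext_coeff_simps)
  then show ?thesis by (metis ext_of_even_inject zero_even_ext_alg.rep_eq)
qed

section \<open>Signed words and powers of the generic matrix over the exterior algebra\<close>

primrec word_sign :: "nat list \<Rightarrow> int" where
  "word_sign [] = 1"
| "word_sign (k # w) = inv_sign {k} (set w) * word_sign w"

text \<open>The element \<open>\<Sum> f k e_k\<close> over all k; it may have infinitely many terms,
  which the unrestricted supports allow.\<close>

lift_definition ext_linear :: "(nat \<Rightarrow> int) \<Rightarrow> ext_alg"
  is "\<lambda>f S. if card S = 1 then f (the_elem S) else 0"
  by auto

lemma ext_parity_linear: "ext_parity 1 (ext_linear f)"
  by (auto simp: ext_parity_def ext_linear.rep_eq)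

lemma ext_coeff_linear_mult:
  assumes "finite S"
  shows "ext_coeff (ext_linear f * g) S = (\<Sum>k\<in>S. inv_sign {k} (S - {k}) * f k * ext_coeff g (S - {k}))"
proof -
  have "ext_coeff (ext_linear f * g) S =
      (\<Sum>T\<in>(\<lambda>k. {k}) ` S. inv_sign T (S - T) * ext_coeff (ext_linear f) T * ext_coeff g (S - T))"
    unfolding times_ext_alg.rep_eq
    using assms by (intro sum.mono_neutral_right) (auto simp: ext_linear.rep_eq card_1_singleton_iff)
  also have "\<dots> = (\<Sum>k\<in>S. inv_sign {k} (S - {k}) * f k * ext_coeff g (S - {k}))"
    by (subst sum.reindex) (auto simp: ext_linear.rep_eq)
  finally show ?thesis .
qed

lemma pow_mat_Suc_left:
  fixes A :: "'a::semiring_1 mat"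
  assumes "A \<in> carrier_mat n n"
  shows "A ^\<^sub>m Suc k = A * A ^\<^sub>m k"
proof (induction k)
  case (Suc k)
  have "A ^\<^sub>m Suc (Suc k) = (A * A ^\<^sub>m k) * A" using Suc by simp
  also have "\<dots> = A * A ^\<^sub>m Suc k" using assms by (simp add: assoc_mult_mat[of A n n _ n _ n])
  finally show ?case .
qed (use assms in simp)

lemma mat_prod_carrier [simp]:
  assumes "\<And>k. k \<in> set w \<Longrightarrow> A k \<in> carrier_mat n n"
  shows "foldr (*) (map A w) (1\<^sub>m n) \<in> carrier_mat n n"
  using assms by (induction w) (auto intro: mult_carrier_mat)

locale ext_mat =
  fixes n :: nat and A :: "nat \<Rightarrow> int mat"
  assumes A: "\<And>k. A k \<in> carrier_mat n n"
begin

definition \<Theta> :: "ext_alg mat" where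
  "\<Theta> = mat n n (\<lambda>(i, j). ext_linear (\<lambda>k. A k $$ (i, j)))"

lemma \<Theta>: "\<Theta> \<in> carrier_mat n n" "\<Theta> ^\<^sub>m m \<in> carrier_mat n n"
  by (simp_all add: \<Theta>_def)

lemma \<Theta>_pow_Suc:
  assumes "i < n" "j < n"
  shows "(\<Theta> ^\<^sub>m Suc m) $$ (i, j) = (\<Sum>k<n. \<Theta> $$ (i, k) * (\<Theta> ^\<^sub>m m) $$ (k, j))"
    "(\<Theta> ^\<^sub>m Suc m) $$ (i, j) = (\<Sum>k<n. (\<Theta> ^\<^sub>m m) $$ (i, k) * \<Theta> $$ (k, j))"
  using assms \<Theta>(1) \<Theta>(2)[of m]
  by (simp add: pow_mat_Suc_left[OF \<Theta>(1)] scalar_prod_def atLeast0LessThan del: pow_mat.simps,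
      simp add: scalar_prod_def atLeast0LessThan)

lemma ext_parity_\<Theta>_pow: "i < n \<Longrightarrow> j < n \<Longrightarrow> ext_parity m ((\<Theta> ^\<^sub>m m) $$ (i, j))"
proof (induction m arbitrary: i j)
  case 0
  then show ?case using \<Theta>(1) by (auto simp: ext_parity_def ext_coeff_simps)
next
  case (Suc m)
  show ?case
    unfolding \<Theta>_pow_Suc(2)[OF Suc.prems]
  proof (rule ext_parity_sum)
    fix k assume "k \<in> {..<n}"
    then show "ext_parity (Suc m) ((\<Theta> ^\<^sub>m m) $$ (i, k) * \<Theta> $$ (k, j))"
      using ext_parity_mult[OF Suc.IH[of i k] ext_parity_linear] Suc.prems by (auto simp: \<Theta>_def)
  qed
qed

text \<open>Removing the leftmost factor of the power picks the first letter \<open>s\<close> of the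
  word, with the sign of sorting it into \<open>S - {s}\<close>. This is how the standard polynomial
  enters: as a coefficient of a power of \<Theta>.\<close>

lemma ext_coeff_\<Theta>_pow:
  assumes "finite S" "card S = m" "i < n" "j < n"
  shows "ext_coeff ((\<Theta> ^\<^sub>m m) $$ (i, j)) S =
    (\<Sum>w\<in>permutations_of_set S. word_sign w * foldr (*) (map A w) (1\<^sub>m n) $$ (i, j))"
  using assms
proof (induction m arbitrary: S i j)
  case 0
  then show ?case using \<Theta>(1) by (auto simp: ext_coeff_simps)
next
  case (Suc m)
  let ?P = "\<lambda>w. foldr (*) (map A w) (1\<^sub>m n)"
  have car: "?P w \<in> carrier_mat n n" for w using A by simp
  have ne: "S \<noteq> {}" using Suc by auto
  have "ext_coeff ((\<Theta> ^\<^sub>m Suc m) $$ (i, j)) S =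
      (\<Sum>k<n. \<Sum>s\<in>S. inv_sign {s} (S - {s}) * A s $$ (i, k) * ext_coeff ((\<Theta> ^\<^sub>m m) $$ (k, j)) (S - {s}))"
    unfolding \<Theta>_pow_Suc(1)[OF Suc.prems(3,4)] ext_coeff_sum using Suc.prems
    by (intro sum.cong refl) (simp add: \<Theta>_def ext_coeff_linear_mult)
  also have "\<dots> = (\<Sum>k<n. \<Sum>s\<in>S. inv_sign {s} (S - {s}) * A s $$ (i, k) *
      (\<Sum>w\<in>permutations_of_set (S - {s}). word_sign w * ?P w $$ (k, j)))"
    using Suc.prems by (intro sum.cong refl arg_cong2[of _ _ _ _ "(*)"] Suc.IH) auto
  also have "\<dots> = (\<Sum>s\<in>S. \<Sum>w\<in>permutations_of_set (S - {s}).
      \<Sum>k<n. inv_sign {s} (S - {s}) * A s $$ (i, k) * (word_sign w * ?P w $$ (k, j)))"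
    unfolding sum_distrib_left
    by (subst sum.swap, intro sum.cong refl, rule sum.swap)
  also have "\<dots> = (\<Sum>s\<in>S. \<Sum>w\<in>permutations_of_set (S - {s}).
      word_sign (s # w) * ?P (s # w) $$ (i, j))"
  proof (intro sum.cong refl)
    fix s w assume w: "w \<in> permutations_of_set (S - {s})"
    have "(A s * ?P w) $$ (i, j) = (\<Sum>k<n. A s $$ (i, k) * ?P w $$ (k, j))"
      using A[of s] car[of w] Suc.prems by (simp add: scalar_prod_def atLeast0LessThan)
    then show "(\<Sum>k<n. inv_sign {s} (S - {s}) * A s $$ (i, k) * (word_sign w * ?P w $$ (k, j))) =
      word_sign (s # w) * ?P (s # w) $$ (i, j)"
      using permutations_of_setD(1)[OF w] by (simp add: sum_distrib_left mult_ac)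
  qed
  also have "\<dots> = (\<Sum>w\<in>(\<Union>s\<in>S. (#) s ` permutations_of_set (S - {s})).
      word_sign w * ?P w $$ (i, j))"
    using Suc.prems by (subst sum.UNION_disjoint) (auto simp: sum.reindex)
  also have "(\<Union>s\<in>S. (#) s ` permutations_of_set (S - {s})) = permutations_of_set S"
    using permutations_of_set_nonempty[OF ne] by simp
  finally show ?case .
qed

definition B :: "even_ext_alg mat" where
  "B = mat n n (\<lambda>(i, j). even_of_ext ((\<Theta> ^\<^sub>m 2) $$ (i, j)))"

lemma ext_of_even_B_pow:
  "i < n \<Longrightarrow> j < n \<Longrightarrow> ext_of_even ((B ^\<^sub>m k) $$ (i, j)) = (\<Theta> ^\<^sub>m (2 * k)) $$ (i, j)"
proof (induction k arbitrary: i j)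
  case 0
  then show ?case
    using \<Theta>(1) by (simp add: B_def one_even_ext_alg.rep_eq zero_even_ext_alg.rep_eq)
next
  case (Suc k)
  have B: "B \<in> carrier_mat n n" "B ^\<^sub>m k \<in> carrier_mat n n" by (simp_all add: B_def)
  have "ext_of_even (B $$ (i, j)) = (\<Theta> ^\<^sub>m 2) $$ (i, j)" if "i < n" "j < n" for i j
    using that ext_parity_\<Theta>_pow[of i j 2] 
    by (simp add: B_def ext_parity_def even_of_ext_inverse del: pow_mat.simps)
  with Suc B have "ext_of_even ((B ^\<^sub>m Suc k) $$ (i, j)) =
      (\<Sum>l<n. (\<Theta> ^\<^sub>m (2 * k)) $$ (i, l) * (\<Theta> ^\<^sub>m 2) $$ (l, j))"
    by (simp add: scalar_prod_def atLeast0LessThan ext_of_even_sum times_even_ext_alg.rep_eq)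
  also have "\<dots> = (\<Theta> ^\<^sub>m (2 * k) * \<Theta> ^\<^sub>m 2) $$ (i, j)"
    using Suc.prems \<Theta>
    by (simp add: scalar_prod_def atLeast0LessThan del: pow_mat.simps)
  also have "\<Theta> ^\<^sub>m (2 * k) * \<Theta> ^\<^sub>m 2 = \<Theta> ^\<^sub>m (2 * Suc k)"
    using \<Theta>(1) \<Theta>(2)[of "2 * k"] by (simp add: numeral_2_eq_2 assoc_mult_mat[of _ n n \<Theta> n \<Theta> n])
  finally show ?case .
qed

text \<open>An even power of \<Theta> is \<Theta> times an odd power. Odd elements anticommute, so
  exchanging the two factors under the trace changes the sign; the trace equals its own negative,
  and 2 can be cancelled.\<close>

lemma trace_B_pow:
  assumes "k > 0"
  shows "(\<Sum>i<n. (B ^\<^sub>m k) $$ (i, i)) = 0"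
proof -
  obtain m where m: "2 * k = Suc m" "odd m" using assms by (cases k) auto
  let ?t = "\<Sum>i<n. (B ^\<^sub>m k) $$ (i, i)"
  have "ext_of_even ?t = (\<Sum>i<n. \<Sum>j<n. \<Theta> $$ (i, j) * (\<Theta> ^\<^sub>m m) $$ (j, i))"
    by (simp add: ext_of_even_sum ext_of_even_B_pow m(1) \<Theta>_pow_Suc(1) del: pow_mat.simps)
  also have "\<dots> = (\<Sum>i<n. \<Sum>j<n. - ((\<Theta> ^\<^sub>m m) $$ (j, i) * \<Theta> $$ (i, j)))"
  proof (intro sum.cong refl)
    fix i j assume "i \<in> {..<n}" "j \<in> {..<n}"
    then show "\<Theta> $$ (i, j) * (\<Theta> ^\<^sub>m m) $$ (j, i) = - ((\<Theta> ^\<^sub>m m) $$ (j, i) * \<Theta> $$ (i, j))"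
      using ext_parity_commute[OF ext_parity_linear ext_parity_\<Theta>_pow[of j i m]] m(2)
      by (auto simp: \<Theta>_def)
  qed
  also have "\<dots> = - (\<Sum>j<n. \<Sum>i<n. (\<Theta> ^\<^sub>m m) $$ (j, i) * \<Theta> $$ (i, j))"
    by (subst sum.swap) (simp add: sum_negf)
  also have "\<dots> = - ext_of_even ?t"
    by (simp add: ext_of_even_sum ext_of_even_B_pow m(1) \<Theta>_pow_Suc(2) del: pow_mat.simps)
  finally have "?t = - ?t" by (metis ext_of_even_inject uminus_even_ext_alg.rep_eq)
  then have "of_nat 2 * ?t = 0" by (metis add.right_inverse mult_2 of_nat_numeral)
  then show ?thesis using even_ext_alg_torsion_free[of 2] by simp
qed

lemma standard_identity_int:
  assumes "finite S" "card S = 2 * n" "i < n" "j < n"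
  shows "(\<Sum>w\<in>permutations_of_set S. word_sign w * foldr (*) (map A w) (1\<^sub>m n) $$ (i, j)) = 0"
proof -
  have "B ^\<^sub>m n = 0\<^sub>m n n"
    by (rule pow_mat_eq_0_of_traces[OF _ trace_B_pow even_ext_alg_torsion_free]) (simp_all add: B_def)
  then have "(\<Theta> ^\<^sub>m (2 * n)) $$ (i, j) = 0"
    using ext_of_even_B_pow[of i j n] assms by (simp add: zero_even_ext_alg.rep_eq del: pow_mat.simps)
  then show ?thesis using ext_coeff_\<Theta>_pow[OF assms] by (simp add: ext_coeff_simps)
qed

end

section \<open>From integer matrices to matrices over any commutative ring\<close>

definition unit_mat :: "nat \<Rightarrow> nat \<times> nat \<Rightarrow> 'a::zero_neq_one mat"
  where "unit_mat n p = mat n n (\<lambda>q. if q = p then 1 else 0)"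

lemma unit_mat_carrier [simp]: "unit_mat n p \<in> carrier_mat n n"
  by (simp add: unit_mat_def)

lemma index_mult_mat_sum:
  assumes "A \<in> carrier_mat n n" "B \<in> carrier_mat n n" "i < n" "j < n"
  shows "(A * B) $$ (i, j) = (\<Sum>k<n. A $$ (i, k) * B $$ (k, j))"
  using assms by (simp add: scalar_prod_def atLeast0LessThan)

lemma index_unit_mat_mult:
  fixes B :: "'a::semiring_1 mat"
  assumes "B \<in> carrier_mat n n" "i < n" "j < n" "b < n"
  shows "(unit_mat n (a, b) * B) $$ (i, j) = (if i = a then B $$ (b, j) else 0)"
proof -
  have "(unit_mat n (a, b) * B) $$ (i, j) = (\<Sum>k<n. unit_mat n (a, b) $$ (i, k) * B $$ (k, j))"
    using assms by (intro index_mult_mat_sum) auto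
  also have "\<dots> = (\<Sum>k<n. if k = b then (if i = a then B $$ (b, j) else 0) else 0)"
    using assms by (intro sum.cong) (auto simp: unit_mat_def)
  finally show ?thesis using assms by simp
qed

text \<open>Multilinear expansion, where \<open>\<kappa>\<close> picks for every letter the position
  of a matrix unit. Since letters are distinct, one choice per letter is one choice per factor.
  Products of units have integer entries, so the ring enters only through the product of entries of
  \<open>A\<close>.\<close>

lemma mat_prod_expand_units:
  fixes A :: "nat \<Rightarrow> 'a::comm_ring_1 mat"
  assumes A: "\<And>k. A k \<in> carrier_mat n n"
    and "distinct w" "i < n" "j < n"
  shows "foldr (*) (map A w) (1\<^sub>m n) $$ (i, j) =
    (\<Sum>\<kappa>\<in>set w \<rightarrow>\<^sub>E {..<n} \<times> {..<n}. (\<Prod>k\<in>set w. A k $$ \<kappa> k) *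
      of_int (foldr (*) (map (\<lambda>k. unit_mat n (\<kappa> k)) w) (1\<^sub>m n) $$ (i, j)))"
  using assms(2-)
proof (induction w arbitrary: i)
  case (Cons s w)
  let ?P = "foldr (*) (map A w) (1\<^sub>m n)"
  let ?E = "\<lambda>\<kappa> w. foldr (*) (map (\<lambda>k. unit_mat n (\<kappa> k)) w) (1\<^sub>m n) :: int mat"
  let ?K = "set w \<rightarrow>\<^sub>E {..<n} \<times> {..<n}"
  have s: "s \<notin> set w" using Cons by auto
  have P: "?P \<in> carrier_mat n n" using A by simp
  have E_upd: "?E (\<kappa>(s := y)) w = ?E \<kappa> w" for \<kappa> y
    using s by (intro arg_cong2[of _ _ _ _ "foldr (*)"]) auto
  have "foldr (*) (map A (s # w)) (1\<^sub>m n) $$ (i, j) = (\<Sum>b<n. A s $$ (i, b) * ?P $$ (b, j))"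
    using A P Cons.prems by (simp add: index_mult_mat_sum)
  also have "\<dots> = (\<Sum>b<n. \<Sum>\<kappa>\<in>?K. A s $$ (i, b) * ((\<Prod>k\<in>set w. A k $$ \<kappa> k) * of_int (?E \<kappa> w $$ (b, j))))"
    using Cons by (intro sum.cong refl) (simp add: sum_distrib_left)
  \<comment> \<open>A row index \<open>a\<close> that must equal \<open>i\<close> is added, so that
    \<open>(a, b)\<close> can become the value of the choice function at \<open>s\<close>.\<close>
  also have "\<dots> = (\<Sum>a<n. \<Sum>b<n. \<Sum>\<kappa>\<in>?K. A s $$ (a, b) * ((\<Prod>k\<in>set w. A k $$ \<kappa> k) *
      of_int (if i = a then ?E \<kappa> w $$ (b, j) else 0)))"
  proof -
    have "(\<Sum>a<n. \<Sum>b<n. \<Sum>\<kappa>\<in>?K. A s $$ (a, b) * ((\<Prod>k\<in>set w. A k $$ \<kappa> k) *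
        of_int (if i = a then ?E \<kappa> w $$ (b, j) else 0))) =
      (\<Sum>a<n. if a = i then \<Sum>b<n. \<Sum>\<kappa>\<in>?K. A s $$ (i, b) * ((\<Prod>k\<in>set w. A k $$ \<kappa> k) * of_int (?E \<kappa> w $$ (b, j))) else 0)"
      by (intro sum.cong) auto
    then show ?thesis using Cons.prems by simp
  qed
  also have "\<dots> = (\<Sum>(a, b)\<in>{..<n} \<times> {..<n}. \<Sum>\<kappa>\<in>?K. A s $$ (a, b) * ((\<Prod>k\<in>set w. A k $$ \<kappa> k) *
      of_int (if i = a then ?E \<kappa> w $$ (b, j) else 0)))"
    by (rule sum.cartesian_product)
  also have "\<dots> = (\<Sum>y\<in>{..<n} \<times> {..<n}. \<Sum>\<kappa>\<in>?K. A s $$ y * (\<Prod>k\<in>set w. A k $$ \<kappa> k) *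
      of_int ((unit_mat n y * ?E \<kappa> w) $$ (i, j)))"
    unfolding case_prod_beta
    using Cons.prems by (intro sum.cong refl) (auto simp: index_unit_mat_mult mult.assoc)
  also have "\<dots> = (\<Sum>(y, \<kappa>)\<in>({..<n} \<times> {..<n}) \<times> ?K. A s $$ y * (\<Prod>k\<in>set w. A k $$ \<kappa> k) *
      of_int ((unit_mat n y * ?E \<kappa> w) $$ (i, j)))"
    by (rule sum.cartesian_product)
  also have "\<dots> = (\<Sum>\<kappa>\<in>(\<lambda>(y, \<kappa>). \<kappa>(s := y)) ` (({..<n} \<times> {..<n}) \<times> ?K).
      (\<Prod>k\<in>set (s # w). A k $$ \<kappa> k) * of_int (?E \<kappa> (s # w) $$ (i, j)))"
  proof (subst sum.reindex)
    show "inj_on (\<lambda>(y, \<kappa>). \<kappa>(s := y)) (({..<n} \<times> {..<n}) \<times> ?K)"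
      using inj_combinator[OF s, of "\<lambda>_. {..<n} \<times> {..<n}"] .
  next
    have "(\<Prod>k\<in>set w. A k $$ (\<kappa>(s := y)) k) = (\<Prod>k\<in>set w. A k $$ \<kappa> k)" for \<kappa> y
      using s by (intro prod.cong) auto
    then show "(\<Sum>(y, \<kappa>)\<in>({..<n} \<times> {..<n}) \<times> ?K. A s $$ y * (\<Prod>k\<in>set w. A k $$ \<kappa> k) *
          of_int ((unit_mat n y * ?E \<kappa> w) $$ (i, j))) =
        sum ((\<lambda>\<kappa>. (\<Prod>k\<in>set (s # w). A k $$ \<kappa> k) * of_int (?E \<kappa> (s # w) $$ (i, j))) \<circ> (\<lambda>(y, \<kappa>). \<kappa>(s := y)))
          (({..<n} \<times> {..<n}) \<times> ?K)"
      using s by (intro sum.cong refl) (auto simp: E_upd simp del: fun_upd_apply, simp)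
  qed
  also have "(\<lambda>(y, \<kappa>). \<kappa>(s := y)) ` (({..<n} \<times> {..<n}) \<times> ?K) = (set (s # w) \<rightarrow>\<^sub>E {..<n} \<times> {..<n})"
    by (simp add: PiE_insert_eq)
  finally show ?case .
qed simp

text \<open>After expansion into matrix units the sum over words is an integer for each choice of
  units, namely the identity already known for integer matrices.\<close>

theorem amitsur_levitzki:
  fixes A :: "nat \<Rightarrow> 'a::comm_ring_1 mat"
  assumes A: "\<And>k. A k \<in> carrier_mat n n"
    and S: "finite S" "card S = 2 * n" and ij: "i < n" "j < n"
  shows "(\<Sum>w\<in>permutations_of_set S. of_int (word_sign w) * foldr (*) (map A w) (1\<^sub>m n) $$ (i, j)) = 0"
proof -
  let ?E = "\<lambda>\<kappa> w. foldr (*) (map (\<lambda>k. unit_mat n (\<kappa> k)) w) (1\<^sub>m n) $$ (i, j) :: int"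
  let ?K = "S \<rightarrow>\<^sub>E {..<n} \<times> {..<n}"
  have "(\<Sum>w\<in>permutations_of_set S. of_int (word_sign w) * foldr (*) (map A w) (1\<^sub>m n) $$ (i, j)) =
    (\<Sum>w\<in>permutations_of_set S. \<Sum>\<kappa>\<in>?K. (\<Prod>k\<in>S. A k $$ \<kappa> k) * of_int (word_sign w * ?E \<kappa> w))"
  proof (intro sum.cong refl)
    fix w assume "w \<in> permutations_of_set S"
    then have w: "distinct w" "set w = S" by (auto dest: permutations_of_setD)
    show "of_int (word_sign w) * foldr (*) (map A w) (1\<^sub>m n) $$ (i, j) =
      (\<Sum>\<kappa>\<in>?K. (\<Prod>k\<in>S. A k $$ \<kappa> k) * of_int (word_sign w * ?E \<kappa> w))"
      using mat_prod_expand_units[OF A w(1) ij] w(2) by (simp add: sum_distrib_left mult_ac)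
  qed
  also have "\<dots> = (\<Sum>\<kappa>\<in>?K. (\<Prod>k\<in>S. A k $$ \<kappa> k) * of_int (\<Sum>w\<in>permutations_of_set S. word_sign w * ?E \<kappa> w))"
    by (subst sum.swap) (simp add: sum_distrib_left)
  also have "\<dots> = 0"
  proof (intro sum.neutral ballI)
    fix \<kappa>
    interpret ext_mat n "\<lambda>k. unit_mat n (\<kappa> k)" by unfold_locales simp
    show "(\<Prod>k\<in>S. A k $$ \<kappa> k) * of_int (\<Sum>w\<in>permutations_of_set S. word_sign w * ?E \<kappa> w) = 0"
      using standard_identity_int[OF S ij] by simp
  qed
  finally show ?thesis .
qed

section \<open>Evaluation of noncommutative polynomials\<close>

lemma (in ring) foldr_mult_closed:
  "(\<And>i. r i \<in> carrier R) \<Longrightarrow> foldr (\<otimes>) (map r w) \<one> \<in> carrier R"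
  by (induction w) auto

lemma (in ring) int_add_pow_closed: "x \<in> carrier R \<Longrightarrow> [(k::int)] \<cdot> x \<in> carrier R"
  using group.int_pow_closed[OF a_group, of x k] by (simp add: add_pow_def)

lemma (in ring) nc_eval_closed:
  "(\<And>i. r i \<in> carrier R) \<Longrightarrow> nc_eval R r f \<in> carrier R"
  unfolding nc_eval_def by (intro finsum_closed Pi_I int_add_pow_closed foldr_mult_closed)

lemma (in ring_hom_ring) hom_nc_eval:
  assumes "\<And>i. r i \<in> carrier R"
  shows "h (nc_eval R r f) = nc_eval S (\<lambda>i. h (r i)) f"
proof -
  have prod: "h (foldr (\<otimes>\<^bsub>R\<^esub>) (map r w) \<one>\<^bsub>R\<^esub>) = foldr (\<otimes>\<^bsub>S\<^esub>) (map (\<lambda>i. h (r i)) w) \<one>\<^bsub>S\<^esub>" for w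
    using assms by (induction w) (auto simp: R.foldr_mult_closed)
  have int: "h ([k] \<cdot>\<^bsub>R\<^esub> x) = [k] \<cdot>\<^bsub>S\<^esub> h x" if "x \<in> carrier R" for k :: int and x
    using group_hom.hom_int_pow[OF a_group_hom, of x k] that by (simp add: add_pow_def)
  let ?t = "\<lambda>w. [Poly_Mapping.lookup f w] \<cdot>\<^bsub>R\<^esub> foldr (\<otimes>\<^bsub>R\<^esub>) (map r (letters w)) \<one>\<^bsub>R\<^esub>"
  have t: "?t w \<in> carrier R" for w
    by (intro R.int_add_pow_closed R.foldr_mult_closed assms)
  have "h (nc_eval R r f) = (\<Oplus>\<^bsub>S\<^esub>w\<in>Poly_Mapping.keys f. h (?t w))"
    unfolding nc_eval_def using t by (subst hom_finsum) (auto simp: o_def)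
  also have "\<dots> = nc_eval S (\<lambda>i. h (r i)) f"
    unfolding nc_eval_def
    by (intro S.finsum_cong' refl Pi_I S.int_add_pow_closed S.foldr_mult_closed hom_closed assms)
       (simp add: int R.foldr_mult_closed assms prod)
  finally show ?thesis .
qed

lemma index_ring_mat_finsum:
  fixes F :: "'i \<Rightarrow> 'a::comm_ring_1 mat"
  assumes "\<And>x. x \<in> A \<Longrightarrow> F x \<in> carrier_mat n n" "i < n" "j < n" "finite A"
  shows "finsum (ring_mat TYPE('a) n b) F A $$ (i, j) = (\<Sum>x\<in>A. F x $$ (i, j))"
proof -
  interpret ring "ring_mat TYPE('a) n b" by (rule ring_mat)
  show ?thesis
    using assms(4,1-3)
  proof (induction A rule: finite_induct)
    case (insert x A)
    then have "finsum (ring_mat TYPE('a) n b) F A \<in> carrier_mat n n"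
      using finsum_closed[of F A] by (auto simp: ring_mat_simps)
    with insert show ?case
      by (subst finsum_insert) (auto simp: ring_mat_simps)
  qed (simp add: ring_mat_simps)
qed

lemma index_ring_mat_int_mult:
  fixes M :: "'a::comm_ring_1 mat"
  assumes M: "M \<in> carrier_mat n n" and ij: "i < n" "j < n"
  shows "([(k::int)] \<cdot>\<^bsub>ring_mat TYPE('a) n b\<^esub> M) $$ (i, j) = of_int k * M $$ (i, j)"
proof -
  interpret R: ring "ring_mat TYPE('a) n b" by (rule ring_mat)
  let ?p = "\<lambda>m::nat. [m] \<cdot>\<^bsub>ring_mat TYPE('a) n b\<^esub> M"
  have nat: "?p m \<in> carrier_mat n n \<and> ?p m $$ (i, j) = of_nat m * M $$ (i, j)" for m
  proof (induction m)
    case (Suc m)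
    have "?p (Suc m) = ?p m + M" by (simp add: add_pow_def ring_mat_simps)
    then show ?case using Suc M ij by (auto simp: algebra_simps)
  qed (use ij in \<open>simp add: add_pow_def ring_mat_simps\<close>)
  show ?thesis
  proof (cases "k \<ge> 0")
    case True
    then show ?thesis using nat[of "nat k"] by (simp add: add_pow_int_ge of_nat_nat)
  next
    case False
    let ?N = "?p (nat (- k))"
    have N: "?N \<in> carrier_mat n n" using nat by blast
    have "\<ominus>\<^bsub>ring_mat TYPE('a) n b\<^esub> ?N = - ?N"
      using N by (intro R.minus_equality) (auto simp: ring_mat_simps intro: uminus_carrier_mat)
    then show ?thesis using False nat[of "nat (- k)"] N ij
      by (simp add: add_pow_int_lt)
  qed
qed

lemma index_nc_eval_ring_mat:
  fixes r :: "nat \<Rightarrow> 'a::comm_ring_1 mat"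
  assumes r: "\<And>k. r k \<in> carrier_mat n n" and ij: "i < n" "j < n"
  shows "nc_eval (ring_mat TYPE('a) n b) r f $$ (i, j) =
    (\<Sum>w\<in>Poly_Mapping.keys f. of_int (Poly_Mapping.lookup f w) *
      foldr (*) (map r (letters w)) (1\<^sub>m n) $$ (i, j))"
proof -
  interpret R: ring "ring_mat TYPE('a) n b" by (rule ring_mat)
  have car: "foldr (*) (map r w) (1\<^sub>m n) \<in> carrier_mat n n" for w using r by simp
  show ?thesis
    unfolding nc_eval_def ring_mat_simps
    using R.int_add_pow_closed[unfolded ring_mat_simps, OF car]
    by (subst index_ring_mat_finsum[OF _ ij]) (auto simp: index_ring_mat_int_mult[OF car ij])
qed

section \<open>The standard polynomial as a monic noncommutative polynomial\<close>

lift_definition standard_poly :: "nat \<Rightarrow> nc_int_poly" is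
  "\<lambda>m w. if letters w \<in> permutations_of_set {..<m} then word_sign (letters w) else 0"
proof -
  fix m
  have "{w. (if letters w \<in> permutations_of_set {..<m} then word_sign (letters w) else 0) \<noteq> 0} \<subseteq>
      Word ` permutations_of_set {..<m}"
    by (auto split: if_splits) (metis free_monoid.exhaust_sel imageI)
  then show "finite {w. (if letters w \<in> permutations_of_set {..<m} then word_sign (letters w) else 0) \<noteq> 0}"
    by (rule finite_subset) simp
qed

lemma word_sign_nonzero: "word_sign w \<noteq> 0"
  by (induction w) (auto simp: inv_sign_def)

lemma keys_standard_poly: "Poly_Mapping.keys (standard_poly m) = Word ` permutations_of_set {..<m}"
proof -
  have "w \<in> Word ` permutations_of_set {..<m}" if "letters w \<in> permutations_of_set {..<m}" for w
    using that by (metis free_monoid.exhaust_sel imageI)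
  then show ?thesis
    by (auto split: if_splits simp: Poly_Mapping.in_keys_iff standard_poly.rep_eq word_sign_nonzero)
qed

lemma word_sign_upt: "word_sign [a..<b] = 1"
proof (induction "b - a" arbitrary: a)
  case (Suc d)
  then have "[a..<b] = a # [Suc a..<b]" by (intro upt_conv_Cons) simp
  moreover have "inv_sign {a} {Suc a..<b} = 1"
  proof -
    have "{(s, t). s \<in> {a} \<and> t \<in> {Suc a..<b} \<and> t < s} = {}" by auto
    then show ?thesis by (simp only: inv_sign_def card.empty power_0)
  qed
  ultimately show ?case using Suc(1)[of "Suc a"] Suc(2) by simp
qed simp

lemma nc_degree_standard_poly: "nc_degree (standard_poly m) = m"
proof -
  have "(\<lambda>w. length (letters w)) ` Poly_Mapping.keys (standard_poly m) = {m}"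
  proof -
    have "(\<lambda>w. length (letters w)) ` Poly_Mapping.keys (standard_poly m) = (\<lambda>_. m) ` permutations_of_set {..<m}"
      unfolding keys_standard_poly image_image
      using length_finite_permutations_of_set[of _ "{..<m}"] by (intro image_cong) auto
    then show ?thesis by (simp add: image_constant_conv)
  qed
  then show ?thesis by (simp add: nc_degree_def)
qed

lemma nc_monic_standard_poly: "nc_monic (standard_poly m)"
proof -
  have "[0..<m] \<in> permutations_of_set {..<m}" by (intro permutations_of_setI) auto
  then show ?thesis
    unfolding nc_monic_def nc_degree_standard_poly keys_standard_poly
    by (intro bexI[of _ "Word [0..<m]"]) (auto simp: standard_poly.rep_eq word_sign_upt)
qed

lemma standard_poly_vanishes_on_matrices:
  fixes r :: "nat \<Rightarrow> 'a::comm_ring_1 mat"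
  assumes r: "\<And>k. r k \<in> carrier_mat n n"
  shows "nc_eval (ring_mat TYPE('a) n b) r (standard_poly (2 * n)) = 0\<^sub>m n n"
proof -
  interpret R: ring "ring_mat TYPE('a) n b" by (rule ring_mat)
  let ?E = "nc_eval (ring_mat TYPE('a) n b) r (standard_poly (2 * n))"
  have car: "?E \<in> carrier_mat n n"
    using R.nc_eval_closed[of r] r by (simp add: ring_mat_simps)
  have "?E $$ (i, j) = 0" if "i < n" "j < n" for i j
    unfolding index_nc_eval_ring_mat[OF r that] keys_standard_poly
    using amitsur_levitzki[of r n "{..<2 * n}", OF r _ _ that]
    by (subst sum.reindex) (auto simp: inj_on_def standard_poly.rep_eq)
  with car show ?thesis by (intro eq_matI) auto
qed

section \<open>Matrix representations\<close>

text \<open>At most one nonzero entry per row; diagonal matrices and weighted cyclic shifts are both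
  of this shape, and products just compose the index maps.\<close>

definition wmat :: "nat \<Rightarrow> (nat \<Rightarrow> nat) \<Rightarrow> (nat \<Rightarrow> 'a) \<Rightarrow> 'a::comm_ring_1 mat"
  where "wmat n \<pi> F = mat n n (\<lambda>(i, j). if j = \<pi> i then F i else 0)"

lemma wmat_carrier [simp]: "wmat n \<pi> F \<in> carrier_mat n n"
  and wmat_dim [simp]: "dim_row (wmat n \<pi> F) = n" "dim_col (wmat n \<pi> F) = n"
  by (simp_all add: wmat_def)

lemma wmat_mult:
  assumes "\<And>i. i < n \<Longrightarrow> \<pi> i < n"
  shows "wmat n \<pi> F * wmat n \<rho> G = wmat n (\<lambda>i. \<rho> (\<pi> i)) (\<lambda>i. F i * G (\<pi> i))"
proof (rule eq_matI, goal_cases)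
  case (1 i j)
  then have ij: "i < n" "j < n" by (simp_all add: wmat_def)
  have "(wmat n \<pi> F * wmat n \<rho> G) $$ (i, j) = (\<Sum>k<n. wmat n \<pi> F $$ (i, k) * wmat n \<rho> G $$ (k, j))"
    using ij by (intro index_mult_mat_sum) auto
  also have "\<dots> = (\<Sum>k<n. if k = \<pi> i then F i * (if j = \<rho> k then G k else 0) else 0)"
    using ij by (intro sum.cong) (auto simp: wmat_def)
  also have "\<dots> = wmat n (\<lambda>i. \<rho> (\<pi> i)) (\<lambda>i. F i * G (\<pi> i)) $$ (i, j)"
    using ij assms by (simp add: wmat_def)
  finally show ?case .
qed (simp_all add: wmat_def)

lemma index_wmat_mult:
  assumes "M \<in> carrier_mat n n" "i < n" "j < n" "\<pi> i < n"
  shows "(wmat n \<pi> F * M) $$ (i, j) = F i * M $$ (\<pi> i, j)"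
proof -
  have "(wmat n \<pi> F * M) $$ (i, j) = (\<Sum>k<n. wmat n \<pi> F $$ (i, k) * M $$ (k, j))"
    using assms by (intro index_mult_mat_sum) auto
  also have "\<dots> = (\<Sum>k<n. if k = \<pi> i then F i * M $$ (k, j) else 0)"
    using assms by (intro sum.cong) (auto simp: wmat_def)
  finally show ?thesis using assms by simp
qed

text \<open>
  The matrices below are found by localising the algebra at \<open>x\<close> and at the normal element
  \<open>\<theta> = x y - y x\<close>.  There \<open>y = (p - 1)\<inverse> (\<theta> - a) x\<inverse>\<close>, and solving the other two relations for
  \<open>z\<close> gives \<open>z = \<theta>\<inverse> (\<omega> - (b/p) x - s a x\<inverse>) + s x\<inverse>\<close> with \<open>s = c/(1 - p)\<close> and \<open>\<omega>\<close> central.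
  Since \<open>x \<theta> = p \<theta> x\<close>, one lets \<open>x\<close> act by \<open>u p\<^sup>i\<close> and \<open>\<theta>\<close> by \<open>v\<close> times a cyclic shift.
\<close>

locale weyl_matrices =
  fixes l :: nat and p a b c u v \<omega> :: "'f::field"
  assumes root: "primitive_root_of_unity l p" and l: "l > 1"
    and u: "u \<noteq> 0" and v: "v \<noteq> 0"
begin

lemma p: "p \<noteq> 0" "p \<noteq> 1" "p ^ l = 1"
  using root l unfolding primitive_root_of_unity_def by (auto simp: power_0_left dest: spec[of _ "1::nat"])

definition sc :: "nat \<Rightarrow> nat" where "sc i = (if Suc i = l then 0 else Suc i)"
definition pr :: "nat \<Rightarrow> nat" where "pr i = (if i = 0 then l - 1 else i - 1)"
definition wt :: "nat \<Rightarrow> 'f" where "wt i = u * p ^ i"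

lemma sc_pr [simp]: "i < l \<Longrightarrow> sc i < l" "i < l \<Longrightarrow> pr i < l" "i < l \<Longrightarrow> sc (pr i) = i" "i < l \<Longrightarrow> pr (sc i) = i"
  using l by (auto simp: sc_def pr_def)

lemma sc_pr_neq: "i < l \<Longrightarrow> sc i \<noteq> i" "i < l \<Longrightarrow> pr i \<noteq> i"
  using l by (auto simp: sc_def pr_def)

lemma wt_nonzero [simp]: "wt i \<noteq> 0"
  using p u by (simp add: wt_def)

text \<open>At the wrap-around from l - 1 to 0 this is \<open>p ^ l = 1\<close>.\<close>

lemma wt_sc: "i < l \<Longrightarrow> wt (sc i) = p * wt i"
  using p by (auto simp: wt_def sc_def)

lemma wt_pr: "i < l \<Longrightarrow> wt (pr i) = wt i / p"
  using wt_sc[of "pr i"] p by simp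

lemma wt_inj: "i < l \<Longrightarrow> j < l \<Longrightarrow> wt i = wt j \<Longrightarrow> i = j"
proof (induction i j rule: linorder_wlog)
  case (le i j)
  have "p ^ j = p ^ i * p ^ (j - i)" using le by (simp flip: power_add)
  then have "p ^ (j - i) = 1" using le p u by (simp add: wt_def)
  then show ?case using root le unfolding primitive_root_of_unity_def by (metis diff_is_0_eq gr0I le_antisym less_imp_diff_less)
qed simp

definition s where "s = c / (1 - p)"
definition zc where "zc t = \<omega> - (b / p) * t - s * a / t"

definition mX where "mX = wmat l (\<lambda>i. i) wt"
text \<open>The shifts displace the weights. In \<open>mY\<close> the weight is read in column
  \<open>pr i\<close>, where it is \<open>wt i / p\<close>, whence the factor \<open>p\<close>; in
  \<open>mZ\<close> the inverse of \<theta> leads to column \<open>sc i\<close>, so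
  \<open>zc\<close> is taken at \<open>p * wt i\<close>.\<close>

definition mY where "mY = wmat l pr (\<lambda>i. v * p / ((p - 1) * wt i)) + wmat l (\<lambda>i. i) (\<lambda>i. - a / ((p - 1) * wt i))"
definition mZ where "mZ = wmat l sc (\<lambda>i. zc (p * wt i) / v) + wmat l (\<lambda>i. i) (\<lambda>i. s / wt i)"

lemma XYZ_carrier [simp]: "mX \<in> carrier_mat l l" "mY \<in> carrier_mat l l" "mZ \<in> carrier_mat l l"
  by (simp_all add: mX_def mY_def mZ_def)

lemma p_minus_1_nonzero: "p - 1 \<noteq> 0" "1 - p \<noteq> 0"
  using p by auto

lemma mX_mY:
  "mX * mY = wmat l pr (\<lambda>i. v * p / (p - 1)) + wmat l (\<lambda>i. i) (\<lambda>i. - a / (p - 1))"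
  unfolding mX_def mY_def
  by (subst mult_add_distrib_mat[of _ l l _ l]) (auto simp: wmat_mult)

lemma mY_mX:
  "mY * mX = wmat l pr (\<lambda>i. v * p / ((p - 1) * wt i) * wt (pr i)) + wmat l (\<lambda>i. i) (\<lambda>i. - a / (p - 1))"
  unfolding mX_def mY_def
  by (subst add_mult_distrib_mat[of _ l l _ _ l]) (auto simp: wmat_mult)

lemma XY: "mX * mY = p \<cdot>\<^sub>m (mY * mX) + a \<cdot>\<^sub>m 1\<^sub>m l"
  unfolding mX_mY mY_mX using p p_minus_1_nonzero
  by (intro eq_matI) (auto simp: wmat_def wt_pr sc_pr_neq divide_simps, auto simp: algebra_simps)

lemma \<theta>_eq: "mX * mY - mY * mX = wmat l pr (\<lambda>_. v)"
  unfolding mX_mY mY_mX using p p_minus_1_nonzero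
  by (intro eq_matI) (auto simp: wmat_def wt_pr sc_pr_neq divide_simps, auto simp: algebra_simps)

lemma ZX: "mZ * mX = p \<cdot>\<^sub>m (mX * mZ) + c \<cdot>\<^sub>m 1\<^sub>m l"
proof -
  have e: "mX * mZ = wmat l sc (\<lambda>i. wt i * (zc (p * wt i) / v)) + wmat l (\<lambda>i. i) (\<lambda>i. s)"
    unfolding mX_def mZ_def
    by (subst mult_add_distrib_mat[of _ l l _ l]) (auto simp: wmat_mult)
  have e': "mZ * mX = wmat l sc (\<lambda>i. zc (p * wt i) / v * wt (sc i)) + wmat l (\<lambda>i. i) (\<lambda>i. s)"
    unfolding mX_def mZ_def
    by (subst add_mult_distrib_mat[of _ l l _ _ l]) (auto simp: wmat_mult)
  \<comment> \<open>The constant \<open>s\<close> is the fixed point that makes the diagonal part of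
    the relation hold; the shift part rests on \<open>wt (sc i) = p * wt i\<close>.\<close>
  have s: "s = p * s + c" using p_minus_1_nonzero by (simp add: s_def divide_simps) (simp add: algebra_simps)
  show ?thesis
    unfolding e e' using p p_minus_1_nonzero s
    by (intro eq_matI) (auto simp: wmat_def wt_sc sc_pr_neq)
qed

lemma YZ: "mY * mZ = p \<cdot>\<^sub>m (mZ * mY) + b \<cdot>\<^sub>m 1\<^sub>m l"
proof -
  let ?y1 = "\<lambda>i. v * p / ((p - 1) * wt i)" and ?y0 = "\<lambda>i. - a / ((p - 1) * wt i)"
  let ?z1 = "\<lambda>i. zc (p * wt i) / v" and ?z0 = "\<lambda>i. s / wt i"
  have e: "mY * mZ = (wmat l (\<lambda>i. sc (pr i)) (\<lambda>i. ?y1 i * ?z1 (pr i)) + wmat l pr (\<lambda>i. ?y1 i * ?z0 (pr i)))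
      + (wmat l sc (\<lambda>i. ?y0 i * ?z1 i) + wmat l (\<lambda>i. i) (\<lambda>i. ?y0 i * ?z0 i))"
    unfolding mY_def mZ_def
    by (subst add_mult_distrib_mat[of _ l l _ _ l] mult_add_distrib_mat[of _ l l _ l]; simp add: wmat_mult)+
  have e': "mZ * mY = (wmat l (\<lambda>i. pr (sc i)) (\<lambda>i. ?z1 i * ?y1 (sc i)) + wmat l sc (\<lambda>i. ?z1 i * ?y0 (sc i)))
      + (wmat l pr (\<lambda>i. ?z0 i * ?y1 i) + wmat l (\<lambda>i. i) (\<lambda>i. ?z0 i * ?y0 i))"
    unfolding mY_def mZ_def
    by (subst add_mult_distrib_mat[of _ l l _ _ l] mult_add_distrib_mat[of _ l l _ l]; simp add: wmat_mult)+
  \<comment> \<open>The diagonal part is the only one in which \<open>b\<close> appears. The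
    parameter \<omega> cancels in the difference of the two \<open>zc\<close> values, and the
    remaining term in the inverse square of the weight is compensated by the product of the diagonal
    parts of \<open>mY\<close> and \<open>mZ\<close>.\<close>
  have d: "?y1 i * ?z1 (pr i) + ?y0 i * ?z0 i = p * (?z1 i * ?y1 (sc i) + ?z0 i * ?y0 i) + b" if "i < l" for i
  proof -
    let ?t = "wt i"
    have gen: "A + D' = p * (B + D) + b" if "A - p * B = b + (p - 1) * D" "D' = D" for A B D D'
      using that by (simp add: algebra_simps)
    have "?y1 i * ?z1 (pr i) - p * (?z1 i * ?y1 (sc i)) = p * (zc ?t - zc (p * ?t)) / ((p - 1) * ?t)"
      using p v that by (simp add: wt_pr wt_sc diff_divide_distrib right_diff_distrib mult.commute)
    also have "zc ?t - zc (p * ?t) = (p - 1) * (b * ?t / p - s * a / (p * ?t))"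
      using p wt_nonzero[of i] by (simp add: zc_def divide_simps) (simp add: algebra_simps)
    also have "p * \<dots> / ((p - 1) * ?t) = b - s * a / (?t * ?t)"
      using p p_minus_1_nonzero wt_nonzero[of i] by (simp add: divide_simps)
    also have "\<dots> = b + (p - 1) * (?z0 i * ?y0 i)"
      using p p_minus_1_nonzero wt_nonzero[of i] by (simp add: divide_simps)
    finally show ?thesis by (rule gen) (simp add: mult_ac)
  qed
  \<comment> \<open>The two shift directions satisfy the relation without a constant term.\<close>
  have dn: "?y1 i * ?z0 (pr i) = p * (?z0 i * ?y1 i)" if "i < l" for i
    using p p_minus_1_nonzero v that by (simp add: wt_pr mult_ac)
  have up: "?y0 i * ?z1 i = p * (?z1 i * ?y0 (sc i))" if "i < l" for i
    using p p_minus_1_nonzero v that by (simp add: wt_sc mult_ac)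
  show ?thesis
  proof (rule eq_matI, goal_cases)
    case (1 i j)
    then have "i < l" "j < l" by auto
    then show ?case
      unfolding e e' using d[of i] dn[of i] up[of i] by (auto simp: wmat_def algebra_simps)
  qed (simp_all add: mY_def mZ_def)
qed

end

context weyl_matrices
begin

text \<open>The commutator of \<open>mX\<close> and \<open>mY\<close> gives the shift, polynomials
  in \<open>mX\<close> give the diagonal units, and shifting these fills each column. A left-stable
  subspace is taken instead of a subalgebra so that \<open>T\<close> can be the image of a
  representation as well as a set of matrices M with \<open>F M G = 0\<close>, as primeness
  requires.\<close>

lemma generated_subspace_eq_carrier:
  assumes T: "T \<subseteq> carrier_mat l l" and one: "1\<^sub>m l \<in> T"
    and add: "\<And>M N. M \<in> T \<Longrightarrow> N \<in> T \<Longrightarrow> M + N \<in> T"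
    and smult: "\<And>k M. M \<in> T \<Longrightarrow> k \<cdot>\<^sub>m M \<in> T"
    and X: "\<And>M. M \<in> T \<Longrightarrow> mX * M \<in> T" and Y: "\<And>M. M \<in> T \<Longrightarrow> mY * M \<in> T"
  shows "T = carrier_mat l l"
proof -
  note car = subsetD[OF T]
  have shift: "wmat l pr (\<lambda>_. 1) * M \<in> T" if M: "M \<in> T" for M
  proof -
    have "(mX * mY - mY * mX) * M = mX * (mY * M) + (-1) \<cdot>\<^sub>m (mY * (mX * M))"
    proof -
      have "(mX * mY - mY * mX) * M = mX * mY * M - mY * mX * M"
        using car[OF M] by (intro minus_mult_distrib_mat[of _ l l _ _ l] mult_carrier_mat[of _ l l _ l]) auto
      also have "\<dots> = mX * (mY * M) - mY * (mX * M)"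
        using car[OF M] by (simp add: assoc_mult_mat[of _ l l _ l _ l])
      also have "\<dots> = mX * (mY * M) + (-1) \<cdot>\<^sub>m (mY * (mX * M))"
        using car[OF M] by (intro eq_matI) (auto simp del: index_mult_mat(1))
      finally show ?thesis .
    qed
    then have "wmat l pr (\<lambda>_. v) * M \<in> T" using add smult X Y M by (simp add: \<theta>_eq)
    moreover have "inverse v \<cdot>\<^sub>m (wmat l pr (\<lambda>_. v) * M) = wmat l pr (\<lambda>_. 1) * M"
      using v car[OF M]
      by (intro eq_matI) (auto simp: index_wmat_mult simp del: index_mult_mat(1))
    ultimately show ?thesis using smult[OF \<open>wmat l pr (\<lambda>_. v) * M \<in> T\<close>, of "inverse v"] by simp
  qed
  \<comment> \<open>Multiplying by the factors \<open>mX - wt k\<close> scales row i by the product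
    of the \<open>wt i - wt k\<close>; with \<open>K\<close> all rows but one this is Lagrange
    interpolation and isolates that row.\<close>
  have filter: "mat l l (\<lambda>(i, j). (\<Prod>k\<in>K. wt i - wt k) * M $$ (i, j)) \<in> T"
    if "finite K" "M \<in> T" for K M
    using that
  proof (induction K rule: finite_induct)
    case empty
    moreover have "mat l l (\<lambda>(i, j). M $$ (i, j)) = M" using car[OF empty] by (intro eq_matI) auto
    ultimately show ?case by simp
  next
    case (insert k K)
    let ?N = "mat l l (\<lambda>(i, j). (\<Prod>k\<in>K. wt i - wt k) * M $$ (i, j))"
    have "mX * ?N + (- wt k) \<cdot>\<^sub>m ?N = mat l l (\<lambda>(i, j). (\<Prod>k\<in>insert k K. wt i - wt k) * M $$ (i, j))"
      using insert unfolding mX_def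
      by (intro eq_matI) (auto simp: index_wmat_mult left_diff_distrib mult.assoc simp del: index_mult_mat(1))
    moreover have "mX * ?N + (- wt k) \<cdot>\<^sub>m ?N \<in> T"
      by (intro add X smult insert)
    ultimately show ?case by simp
  qed
  have row: "unit_mat l (r, r) \<in> T" if r: "r < l" for r
  proof -
    let ?c = "\<Prod>k\<in>{..<l} - {r}. wt r - wt k"
    have c: "?c \<noteq> 0" using wt_inj r by (force simp: prod_zero_iff)
    have "inverse ?c \<cdot>\<^sub>m mat l l (\<lambda>(i, j). (\<Prod>k\<in>{..<l} - {r}. wt i - wt k) * 1\<^sub>m l $$ (i, j)) \<in> T"
      by (intro smult filter one) simp
    also have "inverse ?c \<cdot>\<^sub>m mat l l (\<lambda>(i, j). (\<Prod>k\<in>{..<l} - {r}. wt i - wt k) * 1\<^sub>m l $$ (i, j)) =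
      unit_mat l (r, r)"
    proof (rule eq_matI, goal_cases)
      case (1 i j)
      then have ij: "i < l" "j < l" by (auto simp: unit_mat_def)
      show ?case
      proof (cases "i = r")
        case False
        then have "(\<Prod>k\<in>{..<l} - {r}. wt i - wt k) = 0" using ij by (intro prod_zero) auto
        then show ?thesis using ij False by (simp add: unit_mat_def)
      qed (use ij c in \<open>auto simp: unit_mat_def\<close>)
    qed (auto simp: unit_mat_def)
    finally show ?thesis .
  qed
  have shift_unit: "wmat l pr (\<lambda>_. 1) * unit_mat l (r, t) = unit_mat l (sc r, t)" if "r < l" for r t
  proof (rule eq_matI, goal_cases)
    case (1 i j)
    then have ij: "i < l" "j < l" by (auto simp: unit_mat_def)
    then have "pr i = r \<longleftrightarrow> i = sc r" using that by auto
    then show ?case using ij by (simp add: index_wmat_mult unit_mat_def del: index_mult_mat(1))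
  qed (auto simp: unit_mat_def)
  have sc_pow: "(sc ^^ m) 0 = m" if "m < l" for m
    using that by (induction m) (auto simp: sc_def)
  have units0: "unit_mat l ((sc ^^ m) r, t) \<in> T" if "r < l" "unit_mat l (r, t) \<in> T" for m r t
  proof (induction m)
    case (Suc m)
    have "(sc ^^ m) r < l" by (induction m) (auto simp: that)
    then show ?case using shift[OF Suc] by (simp add: shift_unit)
  qed (use that in simp)
  have units: "unit_mat l (r, t) \<in> T" if "r < l" "t < l" for r t
  proof -
    have sc_add: "(sc ^^ m) (k::nat) = k + m" if "k + m < l" for k m
      using that by (induction m) (auto simp: sc_def)
    \<comment> \<open>From row t, l - t cyclic steps lead to row 0.\<close>
    have "(sc ^^ Suc (l - 1 - t)) t = 0"
      using that sc_add[of t "l - 1 - t"] by (simp add: sc_def)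
    with units0[OF that(2) row[OF that(2)], of "Suc (l - 1 - t)"]
    have "unit_mat l (0, t) \<in> T" by simp
    with units0[of 0 t r] sc_pow that show ?thesis by (cases "l = 0") auto
  qed
  have zero: "0\<^sub>m l l \<in> T"
  proof -
    have "0 \<cdot>\<^sub>m 1\<^sub>m l = (0\<^sub>m l l :: 'f mat)" by (intro eq_matI) auto
    then show ?thesis using smult[OF one, of 0] by simp
  qed
  have partial: "mat l l (\<lambda>q. if q \<in> P then M $$ q else 0) \<in> T" if "finite P" "P \<subseteq> {..<l} \<times> {..<l}" for P M
    using that
  proof (induction P rule: finite_induct)
    case empty
    have "mat l l (\<lambda>q. 0) = (0\<^sub>m l l :: 'f mat)" by (intro eq_matI) auto
    then show ?case using zero by simp
  next
    case (insert q P)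
    have "M $$ q \<cdot>\<^sub>m unit_mat l q + mat l l (\<lambda>q. if q \<in> P then M $$ q else 0) =
        mat l l (\<lambda>q'. if q' \<in> insert q P then M $$ q' else 0)"
      using insert by (intro eq_matI) (auto simp: unit_mat_def)
    moreover have "M $$ q \<cdot>\<^sub>m unit_mat l q + mat l l (\<lambda>q. if q \<in> P then M $$ q else 0) \<in> T"
      using insert units by (intro add smult insert) auto
    ultimately show ?case by simp
  qed
  show ?thesis
  proof
    show "carrier_mat l l \<subseteq> T"
    proof
      fix M :: "'f mat" assume M: "M \<in> carrier_mat l l"
      then have "mat l l (\<lambda>q. if q \<in> {..<l} \<times> {..<l} then M $$ q else 0) = M"
        by (intro eq_matI) auto
      then show "M \<in> T" using partial[of "{..<l} \<times> {..<l}" M] by simp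
    qed
  qed (rule T)
qed

end

section \<open>Representations of the free algebra and of its Weyl quotient\<close>

lemma poly_mapping_single_add_induct [case_names single add]:
  assumes "\<And>k v. P (Poly_Mapping.single k v)" "\<And>f g. P f \<Longrightarrow> P g \<Longrightarrow> P (f + g)"
  shows "P (f :: 'a \<Rightarrow>\<^sub>0 'b::comm_monoid_add)"
proof (induction f rule: Poly_Mapping.update_induct)
  case const
  show ?case using assms(1)[of undefined 0] by simp
next
  case (update f k v)
  then have "Poly_Mapping.update k v f = f + Poly_Mapping.single k v"
    by (intro poly_mapping_eqI)
       (auto simp: lookup_update lookup_add lookup_single Poly_Mapping.in_keys_iff when_def)
  then show ?case using update assms by simp
qed

lemma sum_keys_add:
  fixes h :: "'a \<Rightarrow> 'b::comm_monoid_add \<Rightarrow> 'c::comm_monoid_add"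
  assumes "\<And>k. h k 0 = 0" "\<And>k a b. h k (a + b) = h k a + h k b"
  shows "(\<Sum>k\<in>Poly_Mapping.keys (f + g). h k (Poly_Mapping.lookup (f + g) k)) =
    (\<Sum>k\<in>Poly_Mapping.keys f. h k (Poly_Mapping.lookup f k)) +
    (\<Sum>k\<in>Poly_Mapping.keys g. h k (Poly_Mapping.lookup g k))"
proof -
  let ?S = "Poly_Mapping.keys f \<union> Poly_Mapping.keys g"
  have ext: "(\<Sum>k\<in>Poly_Mapping.keys e. h k (Poly_Mapping.lookup e k)) = (\<Sum>k\<in>?S. h k (Poly_Mapping.lookup e k))"
    if "Poly_Mapping.keys e \<subseteq> ?S" for e
    using that assms by (intro sum.mono_neutral_left) (auto simp: Poly_Mapping.in_keys_iff)
  have "Poly_Mapping.keys (f + g) \<subseteq> ?S" by (rule Poly_Mapping.keys_add)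
  then have "(\<Sum>k\<in>Poly_Mapping.keys (f + g). h k (Poly_Mapping.lookup (f + g) k)) =
      (\<Sum>k\<in>?S. h k (Poly_Mapping.lookup (f + g) k))" by (rule ext)
  also have "\<dots> = (\<Sum>k\<in>?S. h k (Poly_Mapping.lookup f k)) + (\<Sum>k\<in>?S. h k (Poly_Mapping.lookup g k))"
    by (simp add: lookup_add assms(2) sum.distrib)
  finally show ?thesis by (simp add: ext)
qed

lemma ring_ring_of_type_algebra: "ring (ring_of_type_algebra :: 'a::ring_1 ring)"
proof -
  have "\<exists>y. x + y = 0" for x :: 'a
    using add.right_inverse by blast
  then show ?thesis
    unfolding ring_of_type_algebra_def using add.right_inverse
    by unfold_locales (auto simp: algebra_simps Units_def)
qed

lemma ring_of_type_algebra_simps: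
  "carrier ring_of_type_algebra = UNIV" "monoid.mult ring_of_type_algebra = (*)"
  "monoid.one ring_of_type_algebra = 1" "ring.zero ring_of_type_algebra = 0" "ring.add ring_of_type_algebra = (+)"
  by (simp_all add: ring_of_type_algebra_def)

text \<open>Coefficients pass through the scalar map \<open>hom\<close>, so that the identity on
  \<open>K\<close> and the embedding into Laurent series are treated alike.\<close>

locale free_algebra_rep = comm_ring_hom hom
  for hom :: "'k::comm_ring_1 \<Rightarrow> 'f::comm_ring_1" +
  fixes n :: nat and g :: "'x \<Rightarrow> 'f mat"
  assumes gen_carrier [simp]: "\<And>x. g x \<in> carrier_mat n n"
begin

abbreviation word_mat :: "'x list \<Rightarrow> 'f mat"
  where "word_mat w \<equiv> foldr (*) (map g w) (1\<^sub>m n)"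

definition rep :: "('x, 'k) free_algebra \<Rightarrow> 'f mat" where
  "rep f = mat n n (\<lambda>q. \<Sum>w\<in>Poly_Mapping.keys f. hom (Poly_Mapping.lookup f w) * word_mat (letters w) $$ q)"

lemma word_mat_carrier [simp]: "word_mat w \<in> carrier_mat n n"
  by (induction w) (auto intro!: mult_carrier_mat[of _ n n])

lemma gen_dim [simp]: "dim_row (g x) = n" "dim_col (g x) = n"
  using carrier_matD[OF gen_carrier] by blast+

lemma word_mat_dim [simp]: "dim_row (word_mat w) = n" "dim_col (word_mat w) = n"
  using carrier_matD[OF word_mat_carrier] by blast+

lemma word_mat_append: "word_mat (v @ w) = word_mat v * word_mat w"
proof (induction v)
  case (Cons x v)
  have "g x * (word_mat v * word_mat w) = g x * word_mat v * word_mat w"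
    by (rule assoc_mult_mat[symmetric, OF gen_carrier word_mat_carrier word_mat_carrier])
  with Cons show ?case by simp
qed simp

lemma rep_carrier [simp]: "rep f \<in> carrier_mat n n"
  and rep_dim [simp]: "dim_row (rep f) = n" "dim_col (rep f) = n"
  by (simp_all add: rep_def)

lemma rep_single: "rep (Poly_Mapping.single w k) = hom k \<cdot>\<^sub>m word_mat (letters w)"
  by (intro eq_matI) (auto simp: rep_def)

lemma rep_add: "rep (f + f') = rep f + rep f'"
proof (intro eq_matI)
  fix i j assume "i < dim_row (rep f + rep f')" "j < dim_col (rep f + rep f')"
  then show "rep (f + f') $$ (i, j) = (rep f + rep f') $$ (i, j)"
    using sum_keys_add[of "\<lambda>w k. hom k * word_mat (letters w) $$ (i, j)" f f']
    by (simp add: rep_def hom_distribs distrib_right)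
qed auto

lemma rep_mult: "rep (f * f') = rep f * rep f'"
proof (induction f rule: poly_mapping_single_add_induct)
  case (single w k)
  show ?case
  proof (induction f' rule: poly_mapping_single_add_induct)
    case (single w' k')
    have "hom k \<cdot>\<^sub>m word_mat (letters w) * (hom k' \<cdot>\<^sub>m word_mat (letters w')) =
      (hom k * hom k') \<cdot>\<^sub>m (word_mat (letters w) * word_mat (letters w'))"
      by (simp add: mult_smult_assoc_mat[of _ n n _ n] mult_smult_distrib[of _ n n _ n])
         (intro eq_matI, auto simp: mult_ac simp del: index_mult_mat(1))
    then show ?case
      by (simp add: mult_single rep_single hom_distribs plus_free_monoid_def word_mat_append
        del: map_append foldr_append)
  next
    case (add f f')
    then show ?case by (simp add: distrib_left rep_add mult_add_distrib_mat[of _ n n _ n])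
  qed
next
  case (add f f'')
  then show ?case by (simp add: distrib_right rep_add add_mult_distrib_mat[of _ n n _ _ n])
qed

lemma rep_const: "rep (nc_const k) = hom k \<cdot>\<^sub>m 1\<^sub>m n"
  by (simp add: nc_const_def rep_single zero_free_monoid_def)

lemma rep_var: "rep (nc_var x) = g x"
proof -
  have "1 \<cdot>\<^sub>m g x = g x" using gen_carrier[of x] by (intro eq_matI) auto
  then show ?thesis by (simp add: nc_var_def rep_single right_mult_one_mat[OF gen_carrier])
qed

lemma rep_one: "rep 1 = 1\<^sub>m n"
proof -
  have "rep 1 = rep (nc_const 1)" by (simp add: nc_const_def)
  then show ?thesis by (simp add: rep_const) (intro eq_matI, auto)
qed

lemma rep_zero: "rep 0 = 0\<^sub>m n n"
  by (intro eq_matI) (auto simp: rep_def)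

lemma rep_diff_eq_0_iff: "rep (f - f') = 0\<^sub>m n n \<longleftrightarrow> rep f = rep f'"
proof -
  have "rep f = rep (f - f') + rep f'" by (simp flip: rep_add)
  then have e: "rep f $$ (i, j) = rep (f - f') $$ (i, j) + rep f' $$ (i, j)" if "i < n" "j < n" for i j
    using that by simp
  show ?thesis
  proof
    assume "rep (f - f') = 0\<^sub>m n n"
    then show "rep f = rep f'" using e by (intro eq_matI) auto
  next
    assume "rep f = rep f'"
    then have "rep (f - f') $$ (i, j) = 0" if "i < n" "j < n" for i j
      using e[OF that] by (metis add_cancel_left_left)
    then show "rep (f - f') = 0\<^sub>m n n" by (intro eq_matI) auto
  qed
qed

lemma rep_ring_hom_ring: "ring_hom_ring ring_of_type_algebra (ring_mat TYPE('f) n b) rep"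
proof (rule ring_hom_ringI)
  show "ring (ring_of_type_algebra :: ('x, 'k) free_algebra ring)" by (rule ring_ring_of_type_algebra)
  show "ring (ring_mat TYPE('f) n b)" by (rule ring_mat)
qed (simp_all only: ring_of_type_algebra_simps ring_mat_simps rep_add rep_mult rep_one rep_carrier)

lemma rep_genideal:
  assumes G: "\<And>r. r \<in> G \<Longrightarrow> rep r = 0\<^sub>m n n" and f: "f \<in> Idl\<^bsub>ring_of_type_algebra\<^esub> G"
  shows "rep f = 0\<^sub>m n n"
proof -
  interpret h: ring_hom_ring ring_of_type_algebra "ring_mat TYPE('f) n ()" rep
    by (rule rep_ring_hom_ring)
  have ker: "a_kernel ring_of_type_algebra (ring_mat TYPE('f) n ()) rep = {f. rep f = 0\<^sub>m n n}"
    by (simp only: a_kernel_def' ring_of_type_algebra_simps ring_mat_simps UNIV_I simp_thms)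
  have "Idl\<^bsub>ring_of_type_algebra\<^esub> G \<subseteq> {f. rep f = 0\<^sub>m n n}"
    using h.R.genideal_minimal[OF h.kernel_is_ideal, of G] G unfolding ker by blast
  then show ?thesis using f by blast
qed

end

locale weyl_rep = inj_comm_ring_hom hom
  for hom :: "'k::field \<Rightarrow> 'f::field" +
  fixes q \<alpha> \<beta> \<gamma> :: 'k and l :: nat and u v \<omega> :: 'f
  assumes q: "q \<noteq> 0" and root: "primitive_root_of_unity l (q\<^sup>2)" and l: "l > 1"
    and u: "u \<noteq> 0" and v: "v \<noteq> 0"
begin

lemma primitive_root_hom: "primitive_root_of_unity l (hom (q\<^sup>2))"
  using root unfolding primitive_root_of_unity_def by (metis hom_1_iff hom_power)

text \<open>Multiplying the relation for \<open>x z\<close> by \<open>p = q^2\<close> gives the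
  cyclic form \<open>z x = p x z - p \<beta>\<close>. Hence the third constant, and hence \<gamma>,
  which belongs to \<open>y z\<close>, comes second.\<close>

sublocale weyl_matrices l "hom (q\<^sup>2)" "hom \<alpha>" "hom \<gamma>" "- (hom (q\<^sup>2) * hom \<beta>)" u v \<omega>
  using primitive_root_hom l u v by unfold_locales

definition gen :: "xyz \<Rightarrow> 'f mat" where
  "gen t = (case t of Gen_x \<Rightarrow> mX | Gen_y \<Rightarrow> mY | Gen_z \<Rightarrow> mZ)"

sublocale free_algebra_rep hom l gen
  by unfold_locales (auto simp: gen_def split: xyz.split)

lemma rep_gens: "rep (nc_var Gen_x) = mX" "rep (nc_var Gen_y) = mY" "rep (nc_var Gen_z) = mZ"
  by (simp_all add: rep_var gen_def)

lemma rep_const_mult: "rep (nc_const k * f) = hom k \<cdot>\<^sub>m rep f"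
proof -
  have "1\<^sub>m l * rep f = rep f" by simp
  then show ?thesis by (simp add: rep_mult rep_const mult_smult_assoc_mat[of _ l l _ l])
qed

lemma rep_relators:
  assumes "r \<in> cyclic_weyl_relators q \<alpha> \<beta> \<gamma>"
  shows "rep r = 0\<^sub>m l l"
proof -
  have XZ: "mX * mZ = hom (inverse (q\<^sup>2)) \<cdot>\<^sub>m (mZ * mX) + hom \<beta> \<cdot>\<^sub>m 1\<^sub>m l"
  proof -
    have h: "hom (inverse (q\<^sup>2)) * hom (q\<^sup>2) = 1"
      using q by (simp add: flip: hom_mult)
    have "hom (inverse (q\<^sup>2)) * (hom (q\<^sup>2) * x + - (hom (q\<^sup>2) * hom \<beta>) * d) + hom \<beta> * d = x" for x d
      using h by (simp add: algebra_simps flip: mult.assoc)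
    then show ?thesis
      unfolding ZX using carrier_matD[OF XYZ_carrier(1)] carrier_matD[OF XYZ_carrier(3)]
      by (intro eq_matI) (auto simp del: index_mult_mat(1) index_one_mat(1))
  qed
  show ?thesis
    using assms XY YZ XZ unfolding cyclic_weyl_relators_def Let_def
    by (auto simp: rep_diff_eq_0_iff rep_add rep_const rep_const_mult rep_mult[of "nc_var _"] rep_gens mult.assoc)
qed

lemma rep_eq_0: "f \<in> Idl\<^bsub>ring_of_type_algebra\<^esub> (cyclic_weyl_relators q \<alpha> \<beta> \<gamma>) \<Longrightarrow> rep f = 0\<^sub>m l l"
  by (rule rep_genideal[OF rep_relators])

lemma rep_surj:
  assumes hom: "surj hom" and M: "M \<in> carrier_mat l l"
  obtains f where "rep f = M"
proof -
  have "range rep = carrier_mat l l"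
  proof (rule generated_subspace_eq_carrier)
    show "1\<^sub>m l \<in> range rep" by (metis rangeI rep_one)
    show "M + N \<in> range rep" if "M \<in> range rep" "N \<in> range rep" for M N
      using that by (auto simp flip: rep_add)
    show "k \<cdot>\<^sub>m M \<in> range rep" if "M \<in> range rep" for k M
    proof -
      obtain k' where "k = hom k'" using hom by (metis surjD)
      with that show ?thesis by (auto simp flip: rep_const_mult)
    qed
    show "mX * M \<in> range rep" "mY * M \<in> range rep" if "M \<in> range rep" for M
      using that by (auto simp flip: rep_gens rep_mult)
  qed auto
  then have "M \<in> range rep" using M by simp
  then show ?thesis using that by (metis imageE)
qed

text \<open>The image need not contain the matrix units, it only spans them, so they cannot be
  inserted between f and g directly. The matrices that may stand there form a left-stable subspace
  containing the identity, hence all matrices, and a matrix unit then isolates one entry from each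
  side.\<close>

lemma rep_prime:
  assumes "\<And>r. rep (f * r * g) = 0\<^sub>m l l"
  shows "rep f = 0\<^sub>m l l \<or> rep g = 0\<^sub>m l l"
proof -
  have car: "M * N \<in> carrier_mat l l" if "M \<in> carrier_mat l l" "N \<in> carrier_mat l l" for M N :: "'f mat"
    using that by (rule mult_carrier_mat)
  \<comment> \<open>The quantifier over \<open>r\<close> absorbs left factors from the image, which
    makes \<open>T\<close> stable under \<open>mX\<close> and \<open>mY\<close>.\<close>
  define T where "T = {M \<in> carrier_mat l l. \<forall>r. rep (f * r) * M * rep g = 0\<^sub>m l l}"
  have "T = carrier_mat l l"
  proof (rule generated_subspace_eq_carrier)
    show "1\<^sub>m l \<in> T" using assms by (simp add: T_def rep_mult)
    show "M + N \<in> T" if "M \<in> T" "N \<in> T" for M N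
    proof -
      have "rep (f * r) * (M + N) * rep g = rep (f * r) * M * rep g + rep (f * r) * N * rep g" for r
        using that car[of "rep (f * r)" M] car[of "rep (f * r)" N]
        by (simp add: T_def mult_add_distrib_mat[of _ l l _ l] add_mult_distrib_mat[of _ l l _ _ l])
      then show ?thesis using that by (simp add: T_def)
    qed
    show "k \<cdot>\<^sub>m M \<in> T" if "M \<in> T" for k M
    proof -
      have "rep (f * r) * (k \<cdot>\<^sub>m M) * rep g = k \<cdot>\<^sub>m (rep (f * r) * M * rep g)" for r
        using that car[of "rep (f * r)" M]
        by (simp add: T_def mult_smult_distrib[of _ l l _ l] mult_smult_assoc_mat[of _ l l _ l])
      then show ?thesis using that by (simp add: T_def)
    qed
    have mult: "rep h * M \<in> T" if "M \<in> T" for h M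
    proof -
      have "rep (f * r) * (rep h * M) * rep g = rep (f * (r * h)) * M * rep g" for r
        using that by (simp add: T_def rep_mult assoc_mult_mat[of _ l l _ l _ l] car)
      then show ?thesis using that by (simp add: T_def car)
    qed
    then show "mX * M \<in> T" "mY * M \<in> T" if "M \<in> T" for M
      using that by (simp_all flip: rep_gens)
  qed (auto simp: T_def)
  then have T: "rep f * M * rep g = 0\<^sub>m l l" if "M \<in> carrier_mat l l" for M
  proof -
    have "rep (f * 1) * M * rep g = 0\<^sub>m l l"
      using \<open>T = carrier_mat l l\<close> that unfolding T_def by blast
    then show ?thesis by simp
  qed
  show ?thesis
  proof (rule ccontr)
    assume nonzero: "\<not> ?thesis"
    obtain i j i' j' where ij: "i < l" "j < l" "i' < l" "j' < l"
      and nz: "rep f $$ (i, j) \<noteq> 0" "rep g $$ (i', j') \<noteq> 0"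
    proof -
      have "\<exists>i j. i < l \<and> j < l \<and> rep h $$ (i, j) \<noteq> 0" if "rep h \<noteq> 0\<^sub>m l l" for h
        using that eq_matI[of "rep h" "0\<^sub>m l l"] by auto
      from this[of f] this[of g] nonzero show thesis using that by auto
    qed
    have "(rep f * unit_mat l (j, i') * rep g) $$ (i, j') =
      (\<Sum>k<l. rep f $$ (i, k) * (unit_mat l (j, i') * rep g) $$ (k, j'))"
      using ij by (simp add: assoc_mult_mat[of _ l l _ l _ l] index_mult_mat_sum[of _ l] car del: index_mult_mat(1))
    also have "\<dots> = (\<Sum>k<l. if k = j then rep f $$ (i, k) * rep g $$ (i', j') else 0)"
      using ij by (intro sum.cong) (auto simp: index_unit_mat_mult)
    also have "\<dots> \<noteq> 0" using ij nz by simp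
    finally show False using T[of "unit_mat l (j, i')"] ij by simp
  qed
qed

end

section \<open>Identities of matrix algebras have degree at least twice the size\<close>

lemma sum_sign_Pow:
  assumes "finite S"
  shows "(\<Sum>B\<in>Pow S. (-1::'a::ring_1) ^ card B) = (if S = {} then 1 else 0)"
  using assms
proof (induction S rule: finite_induct)
  case (insert x S)
  have "(\<Sum>B\<in>insert x ` Pow S. (-1::'a) ^ card B) = (\<Sum>B\<in>Pow S. - ((-1) ^ card B))"
  proof (subst sum.reindex)
    show "inj_on (insert x) (Pow S)" using insert by (auto simp: inj_on_def)
    show "sum ((\<lambda>B. (-1::'a) ^ card B) \<circ> insert x) (Pow S) = (\<Sum>B\<in>Pow S. - ((-1) ^ card B))"
    proof (intro sum.cong refl)
      fix B assume "B \<in> Pow S"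
      then have "x \<notin> B" "finite B" using insert finite_subset by auto
      then show "((\<lambda>B. (-1::'a) ^ card B) \<circ> insert x) B = - ((-1) ^ card B)" by simp
    qed
  qed
  moreover have "Pow S \<inter> insert x ` Pow S = {}" using insert by auto
  ultimately show ?case
    using insert by (simp add: Pow_insert sum.union_disjoint sum_negf)
qed simp

text \<open>Inclusion-exclusion; it serves to discard the products that miss some position in
  \<open>D\<close>.\<close>

lemma sum_sign_interval:
  assumes D: "finite D" and A: "A \<subseteq> D"
  shows "(\<Sum>J\<in>{J \<in> Pow D. A \<subseteq> J}. (-1::'a::ring_1) ^ card J) = (if A = D then (-1) ^ card D else 0)"
proof -
  have fin: "finite A" using assms finite_subset by blast
  have "(\<Sum>J\<in>{J \<in> Pow D. A \<subseteq> J}. (-1::'a) ^ card J) = (\<Sum>B\<in>Pow (D - A). (-1) ^ card A * (-1) ^ card B)"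
  proof (rule sum.reindex_bij_witness[of _ "\<lambda>B. A \<union> B" "\<lambda>J. J - A"], goal_cases)
    case (5 J)
    then have "finite J" using D finite_subset by auto
    then have "card J = card A + card (J - A)"
      using 5 fin by (metis (mono_tags, lifting) card_Diff_subset card_mono le_add_diff_inverse mem_Collect_eq)
    then show ?case by (simp add: power_add)
  qed (use A in auto)
  also have "\<dots> = (-1) ^ card A * (\<Sum>B\<in>Pow (D - A). (-1) ^ card B)" by (simp add: sum_distrib_left)
  finally show ?thesis using assms by (auto simp: sum_sign_Pow)
qed

text \<open>The sequence \<open>e_00, e_01, e_11, e_12, ...\<close>, in which each unit starts where
  the previous one ends. Indices up to 2 n - 2 fit into size n.\<close>

definition staircase :: "nat \<Rightarrow> nat \<Rightarrow> 'a::comm_ring_1 mat"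
  where "staircase n m = unit_mat n (m div 2, Suc m div 2)"

lemma staircase_carrier [simp]: "staircase n m \<in> carrier_mat n n"
  by (simp add: staircase_def)

abbreviation staircase_prod :: "nat \<Rightarrow> nat list \<Rightarrow> 'a::comm_ring_1 mat"
  where "staircase_prod n \<pi> \<equiv> foldr (*) (map (staircase n) \<pi>) (1\<^sub>m n)"

lemma index_staircase_prod_Cons:
  assumes "i < n" "j < n" "Suc k div 2 < n"
  shows "(staircase_prod n (k # \<pi>) :: 'a::comm_ring_1 mat) $$ (i, j) =
    (if i = k div 2 then staircase_prod n \<pi> $$ (Suc k div 2, j) else 0)"
  using assms by (simp add: staircase_def index_unit_mat_mult del: index_mult_mat(1))

text \<open>A nonzero product needs each unit to start where the previous one ended, so indices
  cannot decrease. They may repeat at the idempotents \<open>e_ii\<close>; distinctness has to come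
  from counting letters.\<close>

lemma sorted_staircase_prod:
  assumes "\<And>k. k \<in> set \<pi> \<Longrightarrow> Suc k div 2 < n" "i < n" "j < n"
    and "(staircase_prod n \<pi> :: 'a::comm_ring_1 mat) $$ (i, j) \<noteq> 0"
  shows "sorted \<pi> \<and> (\<forall>k\<in>set \<pi>. 2 * i \<le> k)"
  using assms
proof (induction \<pi> arbitrary: i)
  case (Cons k \<pi>)
  have i: "i = k div 2" and nz: "(staircase_prod n \<pi> :: 'a mat) $$ (Suc k div 2, j) \<noteq> 0"
    using Cons.prems index_staircase_prod_Cons[of i n j k \<pi>, where 'a = 'a]
    by (auto split: if_splits simp del: index_mult_mat(1))
  have "sorted \<pi> \<and> (\<forall>k'\<in>set \<pi>. 2 * (Suc k div 2) \<le> k')"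
    by (rule Cons.IH) (use Cons.prems nz in auto)
  moreover have "k \<le> 2 * (Suc k div 2)" "2 * i \<le> k" using i by auto
  ultimately show ?case by (auto intro: order_trans)
qed simp

lemma staircase_prod_upt:
  assumes "d div 2 < n" "m \<le> d"
  shows "(staircase_prod n [m..<d] :: 'a::comm_ring_1 mat) $$ (m div 2, d div 2) = 1"
  using assms
proof (induction "d - m" arbitrary: m)
  case (Suc x)
  then have e: "[m..<d] = m # [Suc m..<d]" by (intro upt_conv_Cons) simp
  have lt: "m div 2 < n" "Suc m div 2 < n" using Suc by linarith+
  have "(staircase_prod n [Suc m..<d] :: 'a mat) $$ (Suc m div 2, d div 2) = 1"
    by (rule Suc(1)) (use Suc in auto)
  then show ?case unfolding e using Suc.prems lt
    by (subst index_staircase_prod_Cons) auto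
qed auto

text \<open>Expanding the product chooses a position in \<open>J\<close> for each letter of
  \<open>v\<close>; \<open>\<pi>\<close> lists the chosen positions.\<close>

lemma mat_prod_of_sums:
  fixes U :: "nat \<Rightarrow> 'a::comm_ring_1 mat"
  assumes U: "\<And>m. U m \<in> carrier_mat n n" and J: "finite J" and ij: "i < n" "j < n"
  shows "foldr (*) (map (\<lambda>x. mat n n (\<lambda>p. \<Sum>m\<in>{m \<in> J. c m = x}. U m $$ p)) v) (1\<^sub>m n) $$ (i, j) =
    (\<Sum>\<pi>\<in>{\<pi>. set \<pi> \<subseteq> J \<and> map c \<pi> = v}. foldr (*) (map U \<pi>) (1\<^sub>m n) $$ (i, j))"
  using ij
proof (induction v arbitrary: i)
  case Nil
  have "{\<pi>. set \<pi> \<subseteq> J \<and> map c \<pi> = []} = {[]}" by auto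
  then show ?case by simp
next
  case (Cons x v)
  let ?r = "\<lambda>x. mat n n (\<lambda>p. \<Sum>m\<in>{m \<in> J. c m = x}. U m $$ p)"
  let ?L = "{\<pi>. set \<pi> \<subseteq> J \<and> map c \<pi> = v}" and ?K = "{m \<in> J. c m = x}"
  have fin: "finite ?L"
    by (rule finite_subset[OF _ finite_lists_length_eq[OF J, of "length v"]]) auto
  have prod_car: "foldr (*) (map U \<pi>) (1\<^sub>m n) \<in> carrier_mat n n" for \<pi> using U by simp
  have "foldr (*) (map ?r (x # v)) (1\<^sub>m n) $$ (i, j) =
      (\<Sum>k<n. ?r x $$ (i, k) * foldr (*) (map ?r v) (1\<^sub>m n) $$ (k, j))"
    using Cons.prems by (simp add: index_mult_mat_sum[of _ n] del: index_mult_mat(1))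
  also have "\<dots> = (\<Sum>k<n. (\<Sum>m\<in>?K. U m $$ (i, k)) * (\<Sum>\<pi>\<in>?L. foldr (*) (map U \<pi>) (1\<^sub>m n) $$ (k, j)))"
    using Cons by (intro sum.cong refl) simp
  also have "\<dots> = (\<Sum>m\<in>?K. \<Sum>\<pi>\<in>?L. \<Sum>k<n. U m $$ (i, k) * foldr (*) (map U \<pi>) (1\<^sub>m n) $$ (k, j))"
    unfolding sum_product by (subst sum.swap, intro sum.cong refl, rule sum.swap)
  also have "\<dots> = (\<Sum>m\<in>?K. \<Sum>\<pi>\<in>?L. foldr (*) (map U (m # \<pi>)) (1\<^sub>m n) $$ (i, j))"
    using Cons.prems U prod_car by (simp add: index_mult_mat_sum[of _ n] del: index_mult_mat(1))
  also have "\<dots> = (\<Sum>(m, \<pi>)\<in>?K \<times> ?L. foldr (*) (map U (m # \<pi>)) (1\<^sub>m n) $$ (i, j))"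
    by (rule sum.cartesian_product)
  also have "\<dots> = (\<Sum>\<pi>\<in>{\<pi>. set \<pi> \<subseteq> J \<and> map c \<pi> = x # v}. foldr (*) (map U \<pi>) (1\<^sub>m n) $$ (i, j))"
    by (rule sum.reindex_bij_witness[of _ "\<lambda>\<pi>. (hd \<pi>, tl \<pi>)" "\<lambda>(m, \<pi>). m # \<pi>"]) auto
  finally show ?case .
qed

text \<open>
  Multilinearisation of a monomial \<open>w\<close> of top degree \<open>d\<close> of the identity: a variable \<open>x\<close> is replaced
  by the sum of the staircase units with index in \<open>J\<close> at whose position \<open>w\<close> has the letter \<open>x\<close>.
  The alternating sum over \<open>J \<subseteq> {..<d}\<close> keeps only the products in which each unit occurs once,
  and the staircase units have a nonzero product in one order only.
\<close>

theorem matrix_identity_degree_ge: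
  fixes f :: nc_int_poly
  assumes "nc_monic f"
    and id: "\<And>r. (\<And>k. r k \<in> carrier_mat n n) \<Longrightarrow> nc_eval (ring_mat TYPE('a::comm_ring_1) n ()) r f = 0\<^sub>m n n"
  shows "2 * n \<le> nc_degree f"
proof (rule ccontr)
  assume "\<not> 2 * n \<le> nc_degree f"
  moreover define d where "d = nc_degree f"
  ultimately have d: "d < 2 * n" by simp
  obtain w where w: "Word w \<in> Poly_Mapping.keys f" "length w = d" "Poly_Mapping.lookup f (Word w) = 1"
    using assms(1) unfolding nc_monic_def d_def by (metis free_monoid.exhaust free_monoid.sel)
  have len: "length (letters v) \<le> d" if "v \<in> Poly_Mapping.keys f" for v
    unfolding d_def nc_degree_def using that by (intro Max_ge) auto
  have lt: "Suc k div 2 < n" if "k < d" for k using that d by linarith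
  let ?D = "{..<d}" and ?e = "d div 2"
  have e: "0 < n" "?e < n" using d by auto
  let ?L = "\<lambda>J v. {\<pi>. set \<pi> \<subseteq> J \<and> map ((!) w) \<pi> = v}"
  \<comment> \<open>The full staircase product runs from row 0 to column \<open>d div 2\<close>, so
    this entry detects it.\<close>
  let ?P = "\<lambda>\<pi>. (staircase_prod n \<pi> :: 'a mat) $$ (0, ?e)"
  have finL: "finite (?L ?D v)" for v
    by (rule finite_subset[OF _ finite_lists_length_eq[OF finite_lessThan[of d], of "length v"]]) auto
  define r :: "nat set \<Rightarrow> nat \<Rightarrow> 'a mat"
    where "r J x = mat n n (\<lambda>p. \<Sum>m\<in>{m \<in> J. w ! m = x}. staircase n m $$ p)" for J x
  have r: "r J x \<in> carrier_mat n n" for J x by (simp add: r_def)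
  have eval: "(\<Sum>v\<in>Poly_Mapping.keys f. of_int (Poly_Mapping.lookup f v) * (\<Sum>\<pi>\<in>?L J (letters v). ?P \<pi>)) = 0"
    if "J \<in> Pow ?D" for J
  proof -
    have "finite J" using that finite_subset by auto
    then have "(\<Sum>v\<in>Poly_Mapping.keys f. of_int (Poly_Mapping.lookup f v) * (\<Sum>\<pi>\<in>?L J (letters v). ?P \<pi>)) =
      nc_eval (ring_mat TYPE('a) n ()) (r J) f $$ (0, ?e)"
      unfolding index_nc_eval_ring_mat[OF r e] r_def
      using e by (intro sum.cong refl arg_cong2[of _ _ _ _ "(*)"] mat_prod_of_sums[symmetric]) auto
    also have "\<dots> = 0" using e by (simp add: id[OF r])
    finally show ?thesis .
  qed
  have key: "(\<Sum>J\<in>Pow ?D. (-1) ^ card J * (\<Sum>\<pi>\<in>?L J (letters v). ?P \<pi>)) =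
      (if v = Word w then (-1) ^ d else 0)" if v: "v \<in> Poly_Mapping.keys f" for v
  proof -
    have "(\<Sum>J\<in>Pow ?D. (-1) ^ card J * (\<Sum>\<pi>\<in>?L J (letters v). ?P \<pi>)) =
      (\<Sum>J\<in>Pow ?D. \<Sum>\<pi>\<in>{\<pi> \<in> ?L ?D (letters v). set \<pi> \<subseteq> J}. (-1) ^ card J * ?P \<pi>)"
      unfolding sum_distrib_left by (intro sum.cong refl) auto
    also have "\<dots> = (\<Sum>\<pi>\<in>?L ?D (letters v). \<Sum>J\<in>{J \<in> Pow ?D. set \<pi> \<subseteq> J}. (-1) ^ card J * ?P \<pi>)"
      by (rule sum.swap_restrict) (auto simp: finL)
    also have "\<dots> = (\<Sum>\<pi>\<in>?L ?D (letters v). (if set \<pi> = ?D then (-1) ^ d else 0) * ?P \<pi>)"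
    proof (intro sum.cong refl)
      fix \<pi> assume "\<pi> \<in> ?L ?D (letters v)"
      then have "(\<Sum>J\<in>{J \<in> Pow ?D. set \<pi> \<subseteq> J}. (-1::'a) ^ card J) = (if set \<pi> = ?D then (-1) ^ d else 0)"
        by (subst sum_sign_interval) auto
      then show "(\<Sum>J\<in>{J \<in> Pow ?D. set \<pi> \<subseteq> J}. (-1) ^ card J * ?P \<pi>) =
          (if set \<pi> = ?D then (-1) ^ d else 0) * ?P \<pi>"
        by (simp only: sum_distrib_right[symmetric])
    qed
    also have "\<dots> = (\<Sum>\<pi>\<in>?L ?D (letters v). if \<pi> = [0..<d] then (-1) ^ d else 0)"
    proof (intro sum.cong refl)
      fix \<pi> assume \<pi>: "\<pi> \<in> ?L ?D (letters v)"
      show "(if set \<pi> = ?D then (-1) ^ d else 0) * ?P \<pi> = (if \<pi> = [0..<d] then (-1) ^ d else 0)"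
      proof (cases "set \<pi> = ?D \<and> ?P \<pi> \<noteq> 0")
        case True
        \<comment> \<open>No monomial is longer than d, and \<open>\<pi>\<close> covers all d
          positions, so it repeats none; this also disposes of the monomials of lower
          degree.\<close>
        have "length \<pi> \<le> d" using len[OF v] \<pi> by (metis (mono_tags, lifting) length_map mem_Collect_eq)
        then have "distinct \<pi>"
          using True by (metis card_distinct card_length card_lessThan le_antisym)
        moreover have "sorted \<pi>"
          using sorted_staircase_prod[of \<pi> n 0 ?e, where 'a = 'a] True e lt by auto
        ultimately have "\<pi> = [0..<d]"
          using True sorted_distinct_set_unique[of \<pi> "[0..<d]"] by (simp add: atLeast0LessThan)
        then show ?thesis using staircase_prod_upt[of d n 0, where 'a = 'a] e by (simp add: atLeast0LessThan)
      next
        case False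
        then have "\<pi> \<noteq> [0..<d]" using staircase_prod_upt[of d n 0, where 'a = 'a] e by auto
        then show ?thesis using False by auto
      qed
    qed
    also have "\<dots> = (if [0..<d] \<in> ?L ?D (letters v) then (-1) ^ d else 0)"
      by (simp add: finL)
    \<comment> \<open>The increasing list of positions spells \<open>w\<close>, so no other monomial
      contributes.\<close>
    also have "[0..<d] \<in> ?L ?D (letters v) \<longleftrightarrow> v = Word w"
      using w(2) map_nth[of w] by (cases v) auto
    finally show ?thesis .
  qed
  have "0 = (\<Sum>J\<in>Pow ?D. (-1) ^ card J * (\<Sum>v\<in>Poly_Mapping.keys f.
      of_int (Poly_Mapping.lookup f v) * (\<Sum>\<pi>\<in>?L J (letters v). ?P \<pi>)))"
    by (simp add: eval)
  also have "\<dots> = (\<Sum>v\<in>Poly_Mapping.keys f. of_int (Poly_Mapping.lookup f v) *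
      (\<Sum>J\<in>Pow ?D. (-1) ^ card J * (\<Sum>\<pi>\<in>?L J (letters v). ?P \<pi>)))"
    unfolding sum_distrib_left by (subst sum.swap) (simp add: mult_ac)
  also have "\<dots> = (\<Sum>v\<in>Poly_Mapping.keys f. if v = Word w then (-1) ^ d else 0)"
    using w(3) by (intro sum.cong refl) (auto simp: key)
  also have "\<dots> = (-1) ^ d" using w(1) by simp
  finally show False by (cases "even d") auto
qed

section \<open>Spanning by the ordered monomials\<close>

text \<open>Reordering uses congruences in the ring itself instead of equations in the quotient, so
  that ordinary ring arithmetic applies. Scalars act through the central map
  \<open>con\<close>.\<close>

locale weyl_congruence =
  fixes I :: "'a::ring_1 set" and con :: "'k::comm_ring_1 \<Rightarrow> 'a" and x y z :: 'a
    and a1 a2 a3 b1 b2 b3 :: 'k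
  assumes I_zero: "0 \<in> I" and I_add: "\<And>f g. f \<in> I \<Longrightarrow> g \<in> I \<Longrightarrow> f + g \<in> I"
    and I_left: "\<And>f g. f \<in> I \<Longrightarrow> g * f \<in> I" and I_right: "\<And>f g. f \<in> I \<Longrightarrow> f * g \<in> I"
    and con_zero: "con 0 = 0" and con_one: "con 1 = 1"
    and con_add: "\<And>c d. con (c + d) = con c + con d" and con_mult: "\<And>c d. con (c * d) = con c * con d"
    and con_central: "\<And>c f. f * con c = con c * f"
    and xy: "x * y - (con a1 * y * x + con b1) \<in> I"
    and xz: "x * z - (con a2 * z * x + con b2) \<in> I"
    and yz: "y * z - (con a3 * z * y + con b3) \<in> I"
begin

definition eqv :: "'a \<Rightarrow> 'a \<Rightarrow> bool" (infix "\<asymp>" 50) where "f \<asymp> g \<longleftrightarrow> f - g \<in> I"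

lemma eqv_refl [simp]: "f \<asymp> f" by (simp add: eqv_def I_zero)

lemma eqv_trans [trans]: "f \<asymp> g \<Longrightarrow> g \<asymp> h \<Longrightarrow> f \<asymp> h"
  using I_add[of "f - g" "g - h"] by (simp add: eqv_def)

lemma eqv_add: "f \<asymp> g \<Longrightarrow> f' \<asymp> g' \<Longrightarrow> f + f' \<asymp> g + g'"
  using I_add[of "f - g" "f' - g'"] by (simp add: eqv_def algebra_simps)

lemma eqv_left: "f \<asymp> g \<Longrightarrow> h * f \<asymp> h * g"
  using I_left[of "f - g" h] by (simp add: eqv_def right_diff_distrib)

lemma eqv_right: "f \<asymp> g \<Longrightarrow> f * h \<asymp> g * h"
  using I_right[of "f - g" h] by (simp add: eqv_def left_diff_distrib)

lemma con_left_commute: "f * (con c * g) = con c * (f * g)"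
  by (metis con_central mult.assoc)

lemma commute_power:
  assumes ts: "t * s \<asymp> con a * s * t + con b"
  shows "\<exists>c d. t * s ^ n \<asymp> con c * s ^ n * t + con d * s ^ (n - 1)"
proof -
  have "\<exists>c d. t * s ^ Suc n \<asymp> con c * s ^ Suc n * t + con d * s ^ n" for n
  proof (induction n)
    case 0
    show ?case using ts by (intro exI[of _ a] exI[of _ b]) simp
  next
    case (Suc n)
    then obtain c d where IH: "t * s ^ Suc n \<asymp> con c * s ^ Suc n * t + con d * s ^ n" by blast
    have "t * s ^ Suc (Suc n) = t * s * s ^ Suc n" by (simp add: mult.assoc)
    also have "\<dots> \<asymp> (con a * s * t + con b) * s ^ Suc n" by (rule eqv_right[OF ts])
    also have "\<dots> = con a * s * (t * s ^ Suc n) + con b * s ^ Suc n"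
      by (simp add: distrib_right mult.assoc)
    also have "\<dots> \<asymp> con a * s * (con c * s ^ Suc n * t + con d * s ^ n) + con b * s ^ Suc n"
      by (intro eqv_add eqv_left IH eqv_refl)
    also have "\<dots> = con (a * c) * s ^ Suc (Suc n) * t + con (a * d + b) * s ^ Suc n"
      by (simp add: con_add con_mult distrib_left distrib_right mult.assoc con_left_commute[of s])
    finally show ?case by blast
  qed
  \<comment> \<open>For n = 0 truncated subtraction leaves \<open>s ^ 0\<close>, which the
    coefficient 0 removes.\<close>
  moreover have "t * s ^ 0 \<asymp> con 1 * s ^ 0 * t + con 0 * s ^ (0 - 1)" by (simp add: con_zero con_one)
  ultimately show ?thesis by (cases n) auto
qed

definition pbw_monom :: "nat \<times> nat \<times> nat \<Rightarrow> 'a"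
  where "pbw_monom = (\<lambda>(i, j, k). z ^ i * y ^ j * x ^ k)"

definition pbw :: "(nat \<times> nat \<times> nat \<Rightarrow>\<^sub>0 'k) \<Rightarrow> 'a"
  where "pbw g = (\<Sum>m\<in>Poly_Mapping.keys g. con (Poly_Mapping.lookup g m) * pbw_monom m)"

lemma pbw_add: "pbw (f + g) = pbw f + pbw g"
  unfolding pbw_def by (rule sum_keys_add) (simp_all add: con_zero con_add distrib_right)

lemma pbw_single: "pbw (Poly_Mapping.single m c) = con c * pbw_monom m"
  by (simp add: pbw_def con_zero)

definition spanned :: "'a \<Rightarrow> bool" where "spanned f \<longleftrightarrow> (\<exists>g. f \<asymp> pbw g)"

lemma spanned_eqv: "f \<asymp> g \<Longrightarrow> spanned g \<Longrightarrow> spanned f"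
  unfolding spanned_def using eqv_trans by blast

lemma spanned_add: "spanned f \<Longrightarrow> spanned g \<Longrightarrow> spanned (f + g)"
  unfolding spanned_def by (metis eqv_add pbw_add)

lemma spanned_pbw_monom: "spanned (con c * pbw_monom m)"
  unfolding spanned_def by (metis eqv_refl pbw_single)

lemma spanned_left_mult:
  assumes t: "\<And>m. spanned (t * pbw_monom m)" and f: "spanned f"
  shows "spanned (t * f)"
proof -
  have con: "spanned (con c * f)" if sf: "spanned f" for c f
  proof -
    obtain g where "f \<asymp> pbw g" using sf unfolding spanned_def by blast
    moreover have "spanned (con c * pbw g)"
    proof (induction g rule: poly_mapping_single_add_induct)
      case (single m d)
      then show ?case using spanned_pbw_monom[of "c * d" m] by (simp add: pbw_single con_mult mult.assoc)
    next
      case (add f g)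
      then show ?case by (simp add: pbw_add distrib_left spanned_add)
    qed
    ultimately show ?thesis using eqv_left spanned_eqv by blast
  qed
  obtain g where g: "f \<asymp> pbw g" using f unfolding spanned_def by blast
  have "spanned (t * pbw g)"
  proof (induction g rule: poly_mapping_single_add_induct)
    case (single m d)
    show ?case using con[OF t[of m], of d] by (simp add: pbw_single con_left_commute[of t])
  next
    case (add f g)
    then show ?case by (simp add: pbw_add distrib_left spanned_add)
  qed
  then show ?thesis using eqv_left[OF g] spanned_eqv by blast
qed

lemma spanned_z_mult: "spanned f \<Longrightarrow> spanned (z * f)"
proof (rule spanned_left_mult)
  fix m :: "nat \<times> nat \<times> nat"
  obtain i j k where "m = (i, j, k)" by (cases m) auto
  then have "z * pbw_monom m = con 1 * pbw_monom (Suc i, j, k)"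
    by (simp add: pbw_monom_def con_one mult.assoc)
  then show "spanned (z * pbw_monom m)" by (simp only: spanned_pbw_monom)
qed

lemma spanned_y_mult: "spanned f \<Longrightarrow> spanned (y * f)"
proof (rule spanned_left_mult)
  fix m :: "nat \<times> nat \<times> nat"
  obtain i j k where m: "m = (i, j, k)" by (cases m) auto
  obtain c d where cd: "y * z ^ i \<asymp> con c * z ^ i * y + con d * z ^ (i - 1)"
    using commute_power[OF yz[folded eqv_def], of i] by blast
  have "y * pbw_monom m = y * z ^ i * (y ^ j * x ^ k)" by (simp add: m pbw_monom_def mult.assoc)
  also have "\<dots> \<asymp> (con c * z ^ i * y + con d * z ^ (i - 1)) * (y ^ j * x ^ k)"
    by (rule eqv_right[OF cd])
  also have "\<dots> = con c * pbw_monom (i, Suc j, k) + con d * pbw_monom (i - 1, j, k)"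
    by (simp add: pbw_monom_def distrib_right mult.assoc)
  finally show "spanned (y * pbw_monom m)"
    by (rule spanned_eqv) (intro spanned_add spanned_pbw_monom)
qed

text \<open>Here \<open>x\<close> has to pass first the power of \<open>z\<close> and then that of
  \<open>y\<close>; each constant term lowers an exponent and leaves an ordered monomial
  again.\<close>

lemma spanned_x_mult: "spanned f \<Longrightarrow> spanned (x * f)"
proof (rule spanned_left_mult)
  fix m :: "nat \<times> nat \<times> nat"
  obtain i j k where m: "m = (i, j, k)" by (cases m) auto
  obtain c d where cd: "x * z ^ i \<asymp> con c * z ^ i * x + con d * z ^ (i - 1)"
    using commute_power[OF xz[folded eqv_def], of i] by blast
  obtain c' d' where cd': "x * y ^ j \<asymp> con c' * y ^ j * x + con d' * y ^ (j - 1)"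
    using commute_power[OF xy[folded eqv_def], of j] by blast
  have "x * pbw_monom m = x * z ^ i * (y ^ j * x ^ k)" by (simp add: m pbw_monom_def mult.assoc)
  also have "\<dots> \<asymp> (con c * z ^ i * x + con d * z ^ (i - 1)) * (y ^ j * x ^ k)"
    by (rule eqv_right[OF cd])
  also have "\<dots> = con c * z ^ i * (x * y ^ j * x ^ k) + con d * pbw_monom (i - 1, j, k)"
    by (simp add: pbw_monom_def distrib_right mult.assoc)
  also have "\<dots> \<asymp> con c * z ^ i * ((con c' * y ^ j * x + con d' * y ^ (j - 1)) * x ^ k) + con d * pbw_monom (i - 1, j, k)"
    by (intro eqv_add eqv_left eqv_right[OF cd'] eqv_refl)
  also have "\<dots> = con (c * c') * pbw_monom (i, j, Suc k) + con (c * d') * pbw_monom (i, j - 1, k)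
      + con d * pbw_monom (i - 1, j, k)"
    by (simp add: pbw_monom_def distrib_right distrib_left mult.assoc con_mult con_left_commute[of "z ^ i"])
  finally show "spanned (x * pbw_monom m)"
    by (rule spanned_eqv) (intro spanned_add spanned_pbw_monom)
qed

end

abbreviation weyl_ideal :: "'k \<Rightarrow> 'k \<Rightarrow> 'k \<Rightarrow> 'k \<Rightarrow> (xyz, 'k::field) free_algebra set"
  where "weyl_ideal q \<alpha> \<beta> \<gamma> \<equiv> Idl\<^bsub>ring_of_type_algebra\<^esub> (cyclic_weyl_relators q \<alpha> \<beta> \<gamma>)"

lemma ideal_weyl_ideal: "ideal (weyl_ideal q \<alpha> \<beta> \<gamma>) ring_of_type_algebra"
  by (rule ring.genideal_ideal[OF ring_ring_of_type_algebra])
    (simp only: ring_of_type_algebra_simps subset_UNIV)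

lemma relators_in_weyl_ideal: "cyclic_weyl_relators q \<alpha> \<beta> \<gamma> \<subseteq> weyl_ideal q \<alpha> \<beta> \<gamma>"
  by (rule ring.genideal_self[OF ring_ring_of_type_algebra])
    (simp only: ring_of_type_algebra_simps subset_UNIV)

lemma nc_const_mult_single: "nc_const c * Poly_Mapping.single w k = Poly_Mapping.single w (c * k)"
  "Poly_Mapping.single w k * nc_const c = Poly_Mapping.single w (k * c)"
  by (simp_all add: nc_const_def mult_single)

lemma nc_const_central:
  fixes f :: "('a, 'k::comm_ring_1) free_algebra"
  shows "f * nc_const c = nc_const c * f"
  by (induction f rule: poly_mapping_single_add_induct)
     (simp_all add: nc_const_mult_single distrib_left distrib_right mult.commute)

lemma weyl_congruence_weyl_ideal:
  "weyl_congruence (weyl_ideal q \<alpha> \<beta> \<gamma>) nc_const (nc_var Gen_x) (nc_var Gen_y) (nc_var Gen_z)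
    (q\<^sup>2) (inverse (q\<^sup>2)) (q\<^sup>2) \<alpha> \<beta> \<gamma>"
proof -
  interpret I: ideal "weyl_ideal q \<alpha> \<beta> \<gamma>" ring_of_type_algebra by (rule ideal_weyl_ideal)
  show ?thesis
  proof
    show "0 \<in> weyl_ideal q \<alpha> \<beta> \<gamma>" using additive_subgroup.zero_closed[OF I.additive_subgroup_axioms] by (simp only: ring_of_type_algebra_simps)
    show "f + g \<in> weyl_ideal q \<alpha> \<beta> \<gamma>" if "f \<in> weyl_ideal q \<alpha> \<beta> \<gamma>" "g \<in> weyl_ideal q \<alpha> \<beta> \<gamma>" for f g
      using additive_subgroup.a_closed[OF I.additive_subgroup_axioms that] by (simp only: ring_of_type_algebra_simps)
    show "g * f \<in> weyl_ideal q \<alpha> \<beta> \<gamma>" "f * g \<in> weyl_ideal q \<alpha> \<beta> \<gamma>"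
      if "f \<in> weyl_ideal q \<alpha> \<beta> \<gamma>" for f g
      using I.I_l_closed[OF that, of g] I.I_r_closed[OF that, of g]
      by (simp_all only: ring_of_type_algebra_simps UNIV_I simp_thms True_implies_equals)
    show "nc_var Gen_x * nc_var Gen_y - (nc_const (q\<^sup>2) * nc_var Gen_y * nc_var Gen_x + nc_const \<alpha>)
        \<in> weyl_ideal q \<alpha> \<beta> \<gamma>"
      "nc_var Gen_x * nc_var Gen_z - (nc_const (inverse (q\<^sup>2)) * nc_var Gen_z * nc_var Gen_x + nc_const \<beta>)
        \<in> weyl_ideal q \<alpha> \<beta> \<gamma>"
      "nc_var Gen_y * nc_var Gen_z - (nc_const (q\<^sup>2) * nc_var Gen_z * nc_var Gen_y + nc_const \<gamma>)
        \<in> weyl_ideal q \<alpha> \<beta> \<gamma>"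
      by (rule subsetD[OF relators_in_weyl_ideal], simp only: cyclic_weyl_relators_def Let_def insert_iff simp_thms)+
    show "f * nc_const c = nc_const c * f" for c :: 'a and f :: "(xyz, 'a) free_algebra"
      by (rule nc_const_central)
  qed (simp_all add: nc_const_def single_add mult_single)
qed

text \<open>Left multiplication by a generator preserves the span, so every word lies in it.
  Independence of the ordered monomials comes later, from their degrees in the Laurent
  representations.\<close>

lemma pbw_spanning:
  obtains g where
    "f - weyl_congruence.pbw nc_const (nc_var Gen_x) (nc_var Gen_y) (nc_var Gen_z) g \<in> weyl_ideal q \<alpha> \<beta> \<gamma>"
proof -
  interpret weyl_congruence "weyl_ideal q \<alpha> \<beta> \<gamma>" nc_const "nc_var Gen_x" "nc_var Gen_y" "nc_var Gen_z"
    "q\<^sup>2" "inverse (q\<^sup>2)" "q\<^sup>2" \<alpha> \<beta> \<gamma>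
    by (rule weyl_congruence_weyl_ideal)
  have gen: "spanned (nc_var t * f)" if "spanned f" for t f
    using that by (cases t) (simp_all add: spanned_x_mult spanned_y_mult spanned_z_mult)
  have word: "spanned (Poly_Mapping.single (Word w) 1)" for w
  proof (induction w)
    case Nil
    have "Poly_Mapping.single (Word []) 1 = (nc_const 1 * pbw_monom (0, 0, 0) :: (xyz, 'a) free_algebra)"
      by (simp add: pbw_monom_def nc_const_def zero_free_monoid_def)
    then show ?case by (simp only: spanned_pbw_monom)
  next
    case (Cons t w)
    have "Poly_Mapping.single (Word (t # w)) 1 = nc_var t * (Poly_Mapping.single (Word w) 1 :: (xyz, 'a) free_algebra)"
      by (simp add: nc_var_def mult_single plus_free_monoid_def)
    then show ?case using gen[OF Cons] by (simp only:)
  qed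
  have "spanned f"
  proof (induction f rule: poly_mapping_single_add_induct)
    case (single w k)
    have con: "spanned (nc_const k * pbw_monom m)" for m by (rule spanned_pbw_monom)
    have "spanned (nc_const k * Poly_Mapping.single w 1)"
      by (rule spanned_left_mult[OF con]) (use word[of "letters w"] in simp)
    then show ?case by (simp add: nc_const_mult_single)
  next
    case (add f g)
    then show ?case by (rule spanned_add)
  qed
  then show ?thesis using that unfolding spanned_def eqv_def by blast
qed

section \<open>Degrees in a generic representation\<close>

text \<open>\<open>laurent_mono c e\<close> is \<open>c \<tau>\<^sup>e\<close> for the formal variable \<open>\<tau> = t\<inverse>\<close>, in which degrees are bounded above.\<close>

definition laurent_mono :: "'a \<Rightarrow> int \<Rightarrow> 'a::field fls"
  where "laurent_mono c e = fls_const c * fls_X_intpow (- e)"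

definition deg_le :: "int \<Rightarrow> 'a::field fls \<Rightarrow> bool"
  where "deg_le e f \<longleftrightarrow> (\<forall>n < - e. fls_nth f n = 0)"

definition top_coeff :: "int \<Rightarrow> 'a::field fls \<Rightarrow> 'a"
  where "top_coeff e f = fls_nth f (- e)"

lemma fls_nth_laurent_mono: "fls_nth (laurent_mono c e) n = (if n = - e then c else 0)"
  by (simp add: laurent_mono_def fls_X_intpow_times_conv_shift)

lemma laurent_mono_mult: "laurent_mono c e * laurent_mono d e' = laurent_mono (c * d) (e + e')"
proof -
  have "laurent_mono c e * laurent_mono d e' =
      (fls_const c * fls_const d) * (fls_X_intpow (- e) * fls_X_intpow (- e'))"
    by (simp only: laurent_mono_def mult_ac)
  also have "\<dots> = laurent_mono (c * d) (e + e')"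
    by (simp only: laurent_mono_def fls_const_mult_const fls_X_intpow_times_fls_X_intpow minus_add_distrib)
  finally show ?thesis .
qed

lemma laurent_mono_eq_0_iff [simp]: "laurent_mono c e = 0 \<longleftrightarrow> c = 0"
  by (auto simp: fls_eq_iff fls_nth_laurent_mono)

lemma laurent_mono_divide:
  assumes "d \<noteq> 0"
  shows "laurent_mono c e / laurent_mono d e' = laurent_mono (c / d) (e - e')"
  using assms by (simp add: divide_eq_eq laurent_mono_mult)

lemma fls_const_eq_laurent_mono: "fls_const c = laurent_mono c 0"
  by (simp add: laurent_mono_def)

lemma laurent_mono_1_0 [simp]: "laurent_mono 1 0 = 1"
  by (simp flip: fls_const_eq_laurent_mono)

lemma laurent_mono_power: "laurent_mono c 0 ^ n = laurent_mono (c ^ n) 0"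
  by (simp add: fls_const_power flip: fls_const_eq_laurent_mono)

lemma laurent_mono_diff: "laurent_mono c e - laurent_mono d e = laurent_mono (c - d) e"
  and laurent_mono_uminus: "- laurent_mono c e = laurent_mono (- c) e"
  by (auto simp: fls_eq_iff fls_nth_laurent_mono)

lemma deg_le_laurent_mono: "e \<le> n \<Longrightarrow> deg_le n (laurent_mono c e)"
  by (auto simp: deg_le_def fls_nth_laurent_mono)

lemma top_coeff_laurent_mono: "top_coeff n (laurent_mono c e) = (if n = e then c else 0)"
  by (auto simp: top_coeff_def fls_nth_laurent_mono)

lemma deg_le_0 [simp]: "deg_le e 0" and top_coeff_0 [simp]: "top_coeff e 0 = 0"
  by (simp_all add: deg_le_def top_coeff_def)

lemma deg_le_add: "deg_le e f \<Longrightarrow> deg_le e g \<Longrightarrow> deg_le e (f + g)"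
  and deg_le_diff: "deg_le e f \<Longrightarrow> deg_le e g \<Longrightarrow> deg_le e (f - g)"
  and top_coeff_add: "top_coeff e (f + g) = top_coeff e f + top_coeff e g"
  and top_coeff_diff: "top_coeff e (f - g) = top_coeff e f - top_coeff e g"
  by (simp_all add: deg_le_def top_coeff_def)

lemma deg_le_less: "deg_le e f \<Longrightarrow> e < e' \<Longrightarrow> deg_le e' f \<and> top_coeff e' f = 0"
  by (simp add: deg_le_def top_coeff_def)

lemma top_coeff_sum: "top_coeff e (\<Sum>x\<in>A. f x) = (\<Sum>x\<in>A. top_coeff e (f x))"
  by (induction A rule: infinite_finite_induct) (simp_all add: top_coeff_add)

lemma deg_le_mult:
  assumes f: "deg_le e f" and g: "deg_le e' g"
  shows "deg_le (e + e') (f * g)" and top_coeff_mult: "top_coeff (e + e') (f * g) = top_coeff e f * top_coeff e' g"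
proof -
  have nth: "fls_nth (f * g) n = (\<Sum>i = fls_subdegree f..n - fls_subdegree g. fls_nth f i * fls_nth g (n - i))" for n
    by (rule fls_times_nth)
  show "deg_le (e + e') (f * g)"
    unfolding deg_le_def nth
  proof (intro allI impI sum.neutral ballI)
    fix n i assume "n < - (e + e')"
    then have "i < - e \<or> n - i < - e'" by linarith
    then show "fls_nth f i * fls_nth g (n - i) = 0" using f g by (auto simp: deg_le_def)
  qed
  let ?S = "{fls_subdegree f..- (e + e') - fls_subdegree g}"
  have "top_coeff (e + e') (f * g) = (\<Sum>i\<in>?S. if i = - e then top_coeff e f * top_coeff e' g else 0)"
    unfolding top_coeff_def nth
  proof (intro sum.cong refl)
    fix i
    show "fls_nth f i * fls_nth g (- (e + e') - i) = (if i = - e then fls_nth f (- e) * fls_nth g (- e') else 0)"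
    proof (cases "i = - e")
      case False
      then have "i < - e \<or> - (e + e') - i < - e'" by linarith
      then show ?thesis using f g False by (auto simp: deg_le_def)
    qed simp
  qed
  also have "\<dots> = top_coeff e f * top_coeff e' g"
  proof (cases "- e \<in> ?S")
    case False
    then have "- e < fls_subdegree f \<or> - e' < fls_subdegree g" by auto
    then show ?thesis using False by (auto simp: top_coeff_def)
  qed simp
  finally show "top_coeff (e + e') (f * g) = top_coeff e f * top_coeff e' g" .
qed

text \<open>Left multiplication acts on each column separately, so a single column can witness that
  a product is nonzero. Exactness means that some row attains the bound \<open>e\<close>.\<close>

definition exact_column :: "nat \<Rightarrow> int \<Rightarrow> 'a::field fls mat \<Rightarrow> bool" where
  "exact_column l e N \<longleftrightarrow> N \<in> carrier_mat l l \<and> (\<forall>i<l. deg_le e (N $$ (i, 0))) \<and> (\<exists>i<l. top_coeff e (N $$ (i, 0)) \<noteq> 0)"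

text \<open>The leading part permutes the rows up to factors of exact degree e, and the diagonal
  remainder is at least one degree lower, so it cannot cancel a top coefficient.\<close>

lemma exact_column_mult:
  assumes N: "exact_column l n N" and l: "l > 0"
    and \<pi>: "\<And>i. i < l \<Longrightarrow> \<pi> i < l" "\<And>i. i < l \<Longrightarrow> \<exists>j<l. \<pi> j = i"
    and A: "\<And>i. i < l \<Longrightarrow> deg_le e (A i) \<and> top_coeff e (A i) \<noteq> 0"
    and B: "\<And>i. i < l \<Longrightarrow> deg_le (e - 1) (B i)"
  shows "exact_column l (e + n) ((wmat l \<pi> A + wmat l (\<lambda>i. i) B) * N)"
proof -
  let ?M = "(wmat l \<pi> A + wmat l (\<lambda>i. i) B) * N"
  have car: "N \<in> carrier_mat l l" using N by (simp add: exact_column_def)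
  have "?M = wmat l \<pi> A * N + wmat l (\<lambda>i. i) B * N"
    using car by (intro add_mult_distrib_mat[of _ l l _ _ l]) auto
  then have entry: "?M $$ (i, 0) = A i * N $$ (\<pi> i, 0) + B i * N $$ (i, 0)" if "i < l" for i
    using that car \<pi>(1) l by (simp add: index_wmat_mult del: index_mult_mat(1))
  have le: "deg_le n (N $$ (i, 0))" if "i < l" for i using N that by (simp add: exact_column_def)
  have "deg_le (e + n) (B i * N $$ (i, 0)) \<and> top_coeff (e + n) (B i * N $$ (i, 0)) = 0" if "i < l" for i
    using deg_le_mult(1)[OF B le, OF that that] by (rule deg_le_less) simp
  then have *: "deg_le (e + n) (?M $$ (i, 0)) \<and> top_coeff (e + n) (?M $$ (i, 0)) = top_coeff e (A i) * top_coeff n (N $$ (\<pi> i, 0))"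
    if "i < l" for i
    using deg_le_mult(1)[of e "A i" n] top_coeff_mult[of e "A i" n] A[OF that] le[OF \<pi>(1)[OF that]] that
    by (auto simp: entry top_coeff_add intro!: deg_le_add)
  obtain i j where "i < l" "top_coeff n (N $$ (i, 0)) \<noteq> 0" "j < l" "\<pi> j = i"
    using N \<pi>(2) unfolding exact_column_def by metis
  then have "top_coeff (e + n) (?M $$ (j, 0)) \<noteq> 0" using *[of j] A[of j] by auto
  with * \<open>j < l\<close> show ?thesis using car unfolding exact_column_def by (auto intro!: mult_carrier_mat[of _ l l])
qed

text \<open>
  With \<open>u = \<tau>\<close>, \<open>v = \<tau>\<^sup>D\<^sup>+\<^sup>1\<close> and \<open>\<omega> = \<tau>\<^sup>n\<close> for \<open>n = D\<^sup>2 + D + 1\<close>, the generators \<open>x\<close>, \<open>y\<close>, \<open>z\<close> have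
  the degrees \<open>1\<close>, \<open>D\<close>, \<open>D\<^sup>2\<close>, so the degree of \<open>z\<^sup>i y\<^sup>j x\<^sup>k\<close> determines \<open>(i, j, k)\<close> if \<open>j, k < D\<close>.
\<close>

locale weyl_laurent =
  fixes q \<alpha> \<beta> \<gamma> :: "'k::field" and l D :: nat
  assumes q: "q \<noteq> 0" and root: "primitive_root_of_unity l (q\<^sup>2)" and l: "l > 1" and D: "D > 0"
begin

sublocale weyl_rep fls_const q \<alpha> \<beta> \<gamma> l "laurent_mono 1 1" "laurent_mono 1 (int D + 1)"
  "laurent_mono 1 (int D * int D + int D + 1)"
  using q root l by unfold_locales (auto simp: fls_plus_const)

lemma wt_eq: "wt i = laurent_mono ((q\<^sup>2) ^ i) 1"
  unfolding wt_def by (simp add: fls_const_eq_laurent_mono laurent_mono_power laurent_mono_mult)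

lemma q_powers: "(q\<^sup>2) ^ i \<noteq> 0" "q\<^sup>2 - 1 \<noteq> 0" "q\<^sup>2 * (q\<^sup>2) ^ i \<noteq> 0" "q\<^sup>2 \<noteq> 0"
  using q p(2) by auto

lemma q1: "fls_const (q\<^sup>2) - 1 = laurent_mono (q\<^sup>2 - 1) 0"
  using laurent_mono_diff[of "q\<^sup>2" 0 1] by (simp add: fls_const_eq_laurent_mono)

lemma exact_mX: "exact_column l n N \<Longrightarrow> exact_column l (1 + n) (mX * N)"
proof -
  assume N: "exact_column l n N"
  have "mX = wmat l (\<lambda>i. i) wt + wmat l (\<lambda>i. i) (\<lambda>_. 0)"
    by (intro eq_matI) (auto simp: mX_def wmat_def)
  then show ?thesis
    using exact_column_mult[OF N, of "\<lambda>i. i" 1 wt "\<lambda>_. 0"] l q_powers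
    by (auto simp: wt_eq deg_le_laurent_mono top_coeff_laurent_mono)
qed

lemma exact_mY: "exact_column l n N \<Longrightarrow> exact_column l (int D + n) (mY * N)"
  unfolding mY_def
proof (rule exact_column_mult)
  show "\<exists>j<l. pr j = i" if "i < l" for i using that by (intro exI[of _ "sc i"]) simp
  fix i
  have "laurent_mono 1 (int D + 1) * fls_const (q\<^sup>2) / ((fls_const (q\<^sup>2) - 1) * wt i) =
      laurent_mono (q\<^sup>2 / ((q\<^sup>2 - 1) * (q\<^sup>2) ^ i)) (int D)"
    unfolding q1 wt_eq unfolding fls_const_eq_laurent_mono laurent_mono_mult
    using q_powers by (subst laurent_mono_divide) auto
  then show "deg_le (int D) (laurent_mono 1 (int D + 1) * fls_const (q\<^sup>2) / ((fls_const (q\<^sup>2) - 1) * wt i)) \<and>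
      top_coeff (int D) (laurent_mono 1 (int D + 1) * fls_const (q\<^sup>2) / ((fls_const (q\<^sup>2) - 1) * wt i)) \<noteq> 0"
    using q_powers by (simp add: deg_le_laurent_mono top_coeff_laurent_mono)
  have "- fls_const \<alpha> / ((fls_const (q\<^sup>2) - 1) * wt i) = laurent_mono (- \<alpha> / ((q\<^sup>2 - 1) * (q\<^sup>2) ^ i)) (- 1)"
    unfolding q1 wt_eq unfolding fls_const_eq_laurent_mono laurent_mono_mult laurent_mono_uminus
    using q_powers by (subst laurent_mono_divide) auto
  then show "deg_le (int D - 1) (- fls_const \<alpha> / ((fls_const (q\<^sup>2) - 1) * wt i))"
    using D by (simp add: deg_le_laurent_mono)
qed (use l in auto)

lemma exact_mZ: "exact_column l n N \<Longrightarrow> exact_column l (int D * int D + n) (mZ * N)"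
  unfolding mZ_def
proof (rule exact_column_mult)
  show "\<exists>j<l. sc j = i" if "i < l" for i using that by (intro exI[of _ "pr i"]) simp
  obtain \<sigma> where \<sigma>: "s = laurent_mono \<sigma> 0"
  proof -
    have "1 - fls_const (q\<^sup>2) = laurent_mono (1 - q\<^sup>2) 0"
      using q1 by (metis laurent_mono_uminus minus_diff_eq)
    then have "s = laurent_mono (- (q\<^sup>2 * \<beta>) / (1 - q\<^sup>2)) 0"
      unfolding s_def using q_powers(2)
      by (simp add: fls_const_eq_laurent_mono laurent_mono_mult laurent_mono_uminus laurent_mono_divide)
    then show thesis by (rule that)
  qed
  fix i
  let ?t = "laurent_mono (q\<^sup>2 * (q\<^sup>2) ^ i) 1"
  have DD: "int D > 0" "int D * int D > 0" using D by auto
  have bounds: "- int D \<le> int D * int D" "- 2 - int D \<le> int D * int D"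
      "int D * int D \<noteq> - int D" "int D * int D \<noteq> - 2 - int D" "- 1 \<le> int D * int D - 1"
    using DD by linarith+
  have t: "fls_const (q\<^sup>2) * wt i = ?t"
    unfolding wt_eq by (simp add: fls_const_eq_laurent_mono laurent_mono_mult)
  obtain c c' where "zc ?t = laurent_mono 1 (int D * int D + int D + 1) - laurent_mono c 1 - laurent_mono c' (- 1)"
  proof -
    have "fls_const \<gamma> / fls_const (q\<^sup>2) * ?t = laurent_mono (\<gamma> / q\<^sup>2 * (q\<^sup>2 * (q\<^sup>2) ^ i)) 1"
      using q_powers by (simp add: fls_const_eq_laurent_mono laurent_mono_divide laurent_mono_mult)
    moreover have "s * fls_const \<alpha> / ?t = laurent_mono (\<sigma> * \<alpha> / (q\<^sup>2 * (q\<^sup>2) ^ i)) (- 1)"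
      unfolding \<sigma> unfolding fls_const_eq_laurent_mono laurent_mono_mult using q_powers by (subst laurent_mono_divide) auto
    ultimately have "zc ?t = laurent_mono 1 (int D * int D + int D + 1)
        - laurent_mono (\<gamma> / q\<^sup>2 * (q\<^sup>2 * (q\<^sup>2) ^ i)) 1
        - laurent_mono (\<sigma> * \<alpha> / (q\<^sup>2 * (q\<^sup>2) ^ i)) (- 1)"
      unfolding zc_def by (simp only:)
    then show thesis by (rule that)
  qed
  \<comment> \<open>Division by \<open>v\<close> lowers all exponents by D + 1: the contribution of
    \<omega> gets degree \<open>D * D\<close>, and the other two become negative.\<close>
  then have "zc ?t / laurent_mono 1 (int D + 1) =
      laurent_mono 1 (int D * int D) - laurent_mono c (- int D) - laurent_mono c' (- 2 - int D)"
    by (simp add: diff_divide_distrib laurent_mono_divide)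
  then show "deg_le (int D * int D) (zc (fls_const (q\<^sup>2) * wt i) / laurent_mono 1 (int D + 1)) \<and>
      top_coeff (int D * int D) (zc (fls_const (q\<^sup>2) * wt i) / laurent_mono 1 (int D + 1)) \<noteq> 0"
    unfolding t using bounds by (auto simp: top_coeff_diff top_coeff_laurent_mono intro!: deg_le_diff deg_le_laurent_mono)
  have sw: "s / wt i = laurent_mono (\<sigma> / (q\<^sup>2) ^ i) (- 1)"
    unfolding \<sigma> wt_eq using q_powers by (subst laurent_mono_divide) auto
  show "deg_le (int D * int D - 1) (s / wt i)"
    unfolding sw by (rule deg_le_laurent_mono) (rule bounds(5))
qed (use l in auto)

definition monom_deg :: "nat \<times> nat \<times> nat \<Rightarrow> int" where
  "monom_deg = (\<lambda>(i, j, k). int (i * (D * D) + j * D + k))"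

lemma exact_column_pow:
  assumes "\<And>n N. exact_column l n N \<Longrightarrow> exact_column l (e + n) (rep f * N)" "exact_column l n N"
  shows "exact_column l (int m * e + n) (rep (f ^ m) * N)"
proof (induction m)
  case 0
  have "N \<in> carrier_mat l l" using assms(2) by (simp add: exact_column_def)
  then show ?case using assms(2) by (simp add: rep_one)
next
  case (Suc m)
  have "rep (f ^ Suc m) * N = rep f * (rep (f ^ m) * N)"
    using assms(2) by (simp add: rep_mult exact_column_def assoc_mult_mat[of _ l l _ l _ l])
  moreover have "int (Suc m) * e + n = e + (int m * e + n)" by (simp add: algebra_simps)
  ultimately show ?case using assms(1)[OF Suc] by (simp only:)
qed

lemma exact_column_monom:
  "exact_column l (monom_deg (i, j, k)) (rep (nc_var Gen_z ^ i * nc_var Gen_y ^ j * nc_var Gen_x ^ k))"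
proof -
  have one: "exact_column l 0 (1\<^sub>m l :: 'k fls mat)"
  proof -
    have "deg_le 0 (1 :: 'k fls)" "top_coeff 0 (1 :: 'k fls) = 1"
      using deg_le_laurent_mono[of 0 0 "1::'k"] top_coeff_laurent_mono[of 0 "1::'k" 0] by simp_all
    then show ?thesis using l by (auto simp: exact_column_def intro!: exI[of _ 0])
  qed
  have X: "exact_column l (int k * 1 + 0) (rep (nc_var Gen_x ^ k) * 1\<^sub>m l)"
    by (rule exact_column_pow) (simp_all only: rep_gens exact_mX one)
  have Y: "exact_column l (int j * int D + (int k * 1 + 0)) (rep (nc_var Gen_y ^ j) * (rep (nc_var Gen_x ^ k) * 1\<^sub>m l))"
    by (rule exact_column_pow[OF _ X]) (simp only: rep_gens exact_mY)
  have Z: "exact_column l (int i * (int D * int D) + (int j * int D + (int k * 1 + 0)))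
      (rep (nc_var Gen_z ^ i) * (rep (nc_var Gen_y ^ j) * (rep (nc_var Gen_x ^ k) * 1\<^sub>m l)))"
    by (rule exact_column_pow[OF _ Y]) (simp only: rep_gens exact_mZ)
  have "rep (nc_var Gen_z ^ i) * (rep (nc_var Gen_y ^ j) * (rep (nc_var Gen_x ^ k) * 1\<^sub>m l)) =
      rep (nc_var Gen_z ^ i * nc_var Gen_y ^ j * nc_var Gen_x ^ k)"
    by (simp add: rep_mult assoc_mult_mat[of _ l l _ l _ l])
  moreover have "monom_deg (i, j, k) = int i * (int D * int D) + (int j * int D + (int k * 1 + 0))"
    by (simp add: monom_deg_def)
  ultimately show ?thesis using Z by (simp only:)
qed

text \<open>The degree is written in base \<open>D\<close> with lower digits k and j; the leading
  digit i is unbounded.\<close>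

lemma monom_deg_inj:
  assumes "monom_deg (i, j, k) = monom_deg (i', j', k')" "j < D" "k < D" "j' < D" "k' < D"
  shows "(i, j, k) = (i', j', k')"
proof -
  have e: "(i * D + j) * D + k = (i' * D + j') * D + k'"
    using assms(1) unfolding monom_deg_def by (simp only: case_prod_conv of_nat_eq_iff) (simp add: algebra_simps)
  have "k = k'" using arg_cong[OF e, of "\<lambda>n. n mod D"] assms by simp
  moreover have e': "i * D + j = i' * D + j'" using arg_cong[OF e, of "\<lambda>n. n div D"] assms D by simp
  moreover have "j = j'" using arg_cong[OF e', of "\<lambda>n. n mod D"] assms by simp
  moreover have "i = i'" using arg_cong[OF e', of "\<lambda>n. n div D"] assms D by simp
  ultimately show ?thesis by simp
qed

text \<open>The monomial of largest degree in \<open>g\<close> is unique, and in a row where its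
  column attains that degree nothing can cancel it.\<close>

lemma rep_pbw_nonzero:
  assumes g: "g \<noteq> 0" and small: "\<And>i j k. (i, j, k) \<in> Poly_Mapping.keys g \<Longrightarrow> j < D \<and> k < D"
  shows "rep (weyl_congruence.pbw nc_const (nc_var Gen_x) (nc_var Gen_y) (nc_var Gen_z) g) \<noteq> 0\<^sub>m l l"
proof
  interpret W: weyl_congruence "weyl_ideal q \<alpha> \<beta> \<gamma>" nc_const "nc_var Gen_x" "nc_var Gen_y" "nc_var Gen_z"
    "q\<^sup>2" "inverse (q\<^sup>2)" "q\<^sup>2" \<alpha> \<beta> \<gamma>
    by (rule weyl_congruence_weyl_ideal)
  assume zero: "rep (W.pbw g) = 0\<^sub>m l l"
  have exact: "exact_column l (monom_deg m) (rep (W.pbw_monom m))" for m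
    by (cases m) (simp add: W.pbw_monom_def exact_column_monom)
  let ?K = "Poly_Mapping.keys g"
  have entry: "rep (W.pbw g) $$ (i, 0) =
      (\<Sum>m\<in>?K. fls_const (Poly_Mapping.lookup g m) * rep (W.pbw_monom m) $$ (i, 0))" if "i < l" for i
  proof -
    have "rep (\<Sum>m\<in>K. nc_const (Poly_Mapping.lookup g m) * W.pbw_monom m) $$ (i, 0) =
        (\<Sum>m\<in>K. fls_const (Poly_Mapping.lookup g m) * rep (W.pbw_monom m) $$ (i, 0))" if "finite K" for K
      using that \<open>i < l\<close> l
      by (induction K rule: finite_induct) (auto simp: rep_zero rep_add rep_const_mult)
    then show ?thesis by (simp add: W.pbw_def)
  qed
  have "?K \<noteq> {}" using g by simp
  then have "Max (monom_deg ` ?K) \<in> monom_deg ` ?K" by (intro Max_in) auto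
  then obtain m where m: "m \<in> ?K" and "Max (monom_deg ` ?K) = monom_deg m" by (rule imageE)
  then have max: "monom_deg m' \<le> monom_deg m" if "m' \<in> ?K" for m'
    using Max_ge[of "monom_deg ` ?K" "monom_deg m'"] that by auto
  obtain i where i: "i < l" "top_coeff (monom_deg m) (rep (W.pbw_monom m) $$ (i, 0)) \<noteq> 0"
    using exact[of m] by (auto simp: exact_column_def)
  have const: "top_coeff e (fls_const c * f) = c * top_coeff e f" for e c and f :: "'k fls"
    by (simp add: top_coeff_def)
  have "0 = top_coeff (monom_deg m) (rep (W.pbw g) $$ (i, 0))" using zero i l by simp
  also have "\<dots> = (\<Sum>m'\<in>?K. Poly_Mapping.lookup g m' * top_coeff (monom_deg m) (rep (W.pbw_monom m') $$ (i, 0)))"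
    using i by (simp add: entry top_coeff_sum const)
  also have "\<dots> = (\<Sum>m'\<in>?K. if m' = m then Poly_Mapping.lookup g m * top_coeff (monom_deg m) (rep (W.pbw_monom m) $$ (i, 0)) else 0)"
  proof (intro sum.cong refl)
    fix m' assume m': "m' \<in> ?K"
    show "Poly_Mapping.lookup g m' * top_coeff (monom_deg m) (rep (W.pbw_monom m') $$ (i, 0)) =
        (if m' = m then Poly_Mapping.lookup g m * top_coeff (monom_deg m) (rep (W.pbw_monom m) $$ (i, 0)) else 0)"
    proof (cases "m' = m")
      case False
      then have "monom_deg m' \<noteq> monom_deg m"
        using monom_deg_inj small m' m by (cases m; cases m') blast
      then have "monom_deg m' < monom_deg m" using max[OF m'] by simp
      then have "top_coeff (monom_deg m) (rep (W.pbw_monom m') $$ (i, 0)) = 0"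
        using exact[of m'] i by (auto simp: exact_column_def dest: deg_le_less)
      then show ?thesis using False by simp
    qed simp
  qed
  also have "\<dots> = Poly_Mapping.lookup g m * top_coeff (monom_deg m) (rep (W.pbw_monom m) $$ (i, 0))"
    using m by simp
  finally show False using i m by (simp add: Poly_Mapping.in_keys_iff)
qed

end

context weyl_laurent
begin

text \<open>A name with \<open>D\<close> as an explicit parameter, so that \<open>D\<close> can be
  quantified over outside the locale.\<close>

definition laurent_rep :: "(xyz, 'k) free_algebra \<Rightarrow> 'k fls mat" where "laurent_rep = rep"

lemma laurent_rep_eq_0: "f \<in> weyl_ideal q \<alpha> \<beta> \<gamma> \<Longrightarrow> laurent_rep f = 0\<^sub>m l l"
  unfolding laurent_rep_def by (rule rep_eq_0)

lemma laurent_rep_prime: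
  "(\<And>r. laurent_rep (f * r * g) = 0\<^sub>m l l) \<Longrightarrow> laurent_rep f = 0\<^sub>m l l \<or> laurent_rep g = 0\<^sub>m l l"
  unfolding laurent_rep_def by (rule rep_prime)

lemma laurent_rep_ring_hom_ring:
  "ring_hom_ring ring_of_type_algebra (ring_mat TYPE('k fls) l ()) laurent_rep"
  unfolding laurent_rep_def by (rule rep_ring_hom_ring)

lemma laurent_rep_pbw_nonzero:
  assumes f: "f - weyl_congruence.pbw nc_const (nc_var Gen_x) (nc_var Gen_y) (nc_var Gen_z) g \<in> weyl_ideal q \<alpha> \<beta> \<gamma>"
    and "g \<noteq> 0" "\<And>i j k. (i, j, k) \<in> Poly_Mapping.keys g \<Longrightarrow> j < D \<and> k < D"
  shows "laurent_rep f \<noteq> 0\<^sub>m l l"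
  using rep_pbw_nonzero[OF assms(2,3)] rep_eq_0[OF f] unfolding laurent_rep_def rep_diff_eq_0_iff by simp

end

text \<open>Nonvanishing for all large \<open>D\<close>, and not just for one, lets two elements
  share a representation in the proof of primeness.\<close>

lemma laurent_rep_eventually_nonzero:
  fixes q \<alpha> \<beta> \<gamma> :: "'k::field"
  assumes "q \<noteq> 0" "primitive_root_of_unity l (q\<^sup>2)" "l > 1" and f: "f \<notin> weyl_ideal q \<alpha> \<beta> \<gamma>"
  shows "\<exists>D0. \<forall>D>D0. weyl_laurent.laurent_rep q \<alpha> \<beta> \<gamma> l D f \<noteq> 0\<^sub>m l l"
proof -
  obtain g where g: "f - weyl_congruence.pbw nc_const (nc_var Gen_x) (nc_var Gen_y) (nc_var Gen_z) g \<in> weyl_ideal q \<alpha> \<beta> \<gamma>"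
    by (rule pbw_spanning)
  interpret W: weyl_congruence "weyl_ideal q \<alpha> \<beta> \<gamma>" nc_const "nc_var Gen_x" "nc_var Gen_y" "nc_var Gen_z"
    "q\<^sup>2" "inverse (q\<^sup>2)" "q\<^sup>2" \<alpha> \<beta> \<gamma>
    by (rule weyl_congruence_weyl_ideal)
  have "g \<noteq> 0" using g f by (auto simp: W.pbw_def)
  let ?N = "insert 0 ((\<lambda>(i, j, k). max j k) ` Poly_Mapping.keys g)"
  have bound: "j \<le> Max ?N \<and> k \<le> Max ?N" if "(i, j, k) \<in> Poly_Mapping.keys g" for i j k
  proof -
    have "max j k \<le> Max ?N" using that by (intro Max_ge) force+
    then show ?thesis by simp
  qed
  have "weyl_laurent.laurent_rep q \<alpha> \<beta> \<gamma> l D f \<noteq> 0\<^sub>m l l" if "D > Max ?N" for D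
  proof -
    interpret weyl_laurent q \<alpha> \<beta> \<gamma> l D
      using assms that by unfold_locales auto
    have "j < D \<and> k < D" if "(i, j, k) \<in> Poly_Mapping.keys g" for i j k
      using bound[OF that] \<open>D > Max ?N\<close> by linarith
    then show ?thesis by (rule laurent_rep_pbw_nonzero[OF g \<open>g \<noteq> 0\<close>])
  qed
  then show ?thesis by blast
qed

section \<open>The quotient algebra\<close>

lemma cyclic_weyl_algebra_eq:
  "cyclic_weyl_algebra q \<alpha> \<beta> \<gamma> = ring_of_type_algebra Quot weyl_ideal q \<alpha> \<beta> \<gamma>"
  by (simp only: cyclic_weyl_algebra_def Let_def)

locale weyl_quotient =
  fixes q \<alpha> \<beta> \<gamma> :: "'k::field" and l :: nat
  assumes q: "q \<noteq> 0" and root: "primitive_root_of_unity l (q\<^sup>2)" and l: "l > 1"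
begin

abbreviation I where "I \<equiv> weyl_ideal q \<alpha> \<beta> \<gamma>"
abbreviation A where "A \<equiv> cyclic_weyl_algebra q \<alpha> \<beta> \<gamma>"
definition proj :: "(xyz, 'k) free_algebra \<Rightarrow> (xyz, 'k) free_algebra set"
  where "proj f = I +>\<^bsub>ring_of_type_algebra\<^esub> f"

lemma proj_ring_hom_ring: "ring_hom_ring ring_of_type_algebra A proj"
proof -
  have "proj = (+>\<^bsub>ring_of_type_algebra\<^esub>) I" by (simp add: fun_eq_iff proj_def)
  then show ?thesis
    using ideal.rcos_ring_hom_ring[OF ideal_weyl_ideal] by (simp only: cyclic_weyl_algebra_eq)
qed

sublocale proj: ring_hom_ring ring_of_type_algebra A proj
  by (rule proj_ring_hom_ring)

lemma proj_surj:
  assumes "a \<in> carrier A"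
  obtains f where "a = proj f"
  using assms that
  unfolding cyclic_weyl_algebra_eq FactRing_def A_RCOSETS_def' proj_def by auto

lemma proj_eq_0_iff: "proj f = \<zero>\<^bsub>A\<^esub> \<longleftrightarrow> f \<in> I"
proof -
  interpret I: ideal I ring_of_type_algebra by (rule ideal_weyl_ideal)
  have zero: "\<zero>\<^bsub>A\<^esub> = I" by (simp only: cyclic_weyl_algebra_eq FactRing_def ring.simps monoid.simps)
  have f: "f \<in> carrier ring_of_type_algebra" by (simp only: ring_of_type_algebra_simps UNIV_I)
  show ?thesis
    unfolding zero proj_def using I.a_rcos_const[of f] I.rcos_const_imp_mem[OF f] by blast
qed

lemma in_ideal_if_reps_vanish:
  assumes "\<And>D. D > 0 \<Longrightarrow> weyl_laurent.laurent_rep q \<alpha> \<beta> \<gamma> l D f = 0\<^sub>m l l"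
  shows "f \<in> I"
  using laurent_rep_eventually_nonzero[OF q root l, of f \<alpha> \<beta> \<gamma>] assms by (metis gr0I less_Suc_eq not_less_eq)

lemma weyl_laurent: "D > 0 \<Longrightarrow> weyl_laurent q l D"
  using q root l by unfold_locales

lemma one_notin_ideal: "1 \<notin> I"
proof
  assume "1 \<in> I"
  interpret weyl_laurent q \<alpha> \<beta> \<gamma> l 1 by (rule weyl_laurent) simp
  have "laurent_rep 1 = 1\<^sub>m l" by (simp only: laurent_rep_def rep_one)
  then have "(1\<^sub>m l :: 'k fls mat) = 0\<^sub>m l l"
    using laurent_rep_eq_0[OF \<open>1 \<in> I\<close>] by (simp only:)
  then have "(1\<^sub>m l :: 'k fls mat) $$ (0, 0) = 0\<^sub>m l l $$ (0, 0)" by (rule arg_cong)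
  then show False using l by simp
qed

lemma prime_ring_A: "prime_ring A"
  unfolding prime_ring_def
proof (intro conjI ballI impI)
  show "ring A" by (rule proj.S.ring_axioms)
  have "proj 1 = \<one>\<^bsub>A\<^esub>" using proj.hom_one by (simp only: ring_of_type_algebra_simps)
  then show "\<one>\<^bsub>A\<^esub> \<noteq> \<zero>\<^bsub>A\<^esub>" using one_notin_ideal proj_eq_0_iff by metis
  fix a b assume a: "a \<in> carrier A" and b: "b \<in> carrier A"
    and ab: "\<forall>r\<in>carrier A. a \<otimes>\<^bsub>A\<^esub> r \<otimes>\<^bsub>A\<^esub> b = \<zero>\<^bsub>A\<^esub>"
  obtain f where f: "a = proj f" by (rule proj_surj[OF a])
  obtain g where g: "b = proj g" by (rule proj_surj[OF b])
  have mult: "proj (h * h') = proj h \<otimes>\<^bsub>A\<^esub> proj h'" for h h'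
    using proj.hom_mult[of h h'] by (simp only: ring_of_type_algebra_simps UNIV_I simp_thms True_implies_equals)
  have car: "proj h \<in> carrier A" for h
    using proj.hom_closed[of h] by (simp only: ring_of_type_algebra_simps UNIV_I simp_thms True_implies_equals)
  have fg: "f * r * g \<in> I" for r
    using bspec[OF ab car[of r]] by (simp only: f g mult[symmetric] proj_eq_0_iff)
  show "a = \<zero>\<^bsub>A\<^esub> \<or> b = \<zero>\<^bsub>A\<^esub>"
  proof (rule ccontr)
    assume "\<not> (a = \<zero>\<^bsub>A\<^esub> \<or> b = \<zero>\<^bsub>A\<^esub>)"
    then have "f \<notin> I" "g \<notin> I" unfolding f g proj_eq_0_iff by blast+
    then obtain D1 D2 where D1: "\<forall>D>D1. weyl_laurent.laurent_rep q \<alpha> \<beta> \<gamma> l D f \<noteq> 0\<^sub>m l l"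
      and D2: "\<forall>D>D2. weyl_laurent.laurent_rep q \<alpha> \<beta> \<gamma> l D g \<noteq> 0\<^sub>m l l"
      using laurent_rep_eventually_nonzero[OF q root l] by metis
    let ?D = "Suc (max D1 D2)"
    interpret weyl_laurent q \<alpha> \<beta> \<gamma> l ?D by (rule weyl_laurent) simp
    have "laurent_rep f = 0\<^sub>m l l \<or> laurent_rep g = 0\<^sub>m l l"
      by (rule laurent_rep_prime, rule laurent_rep_eq_0, rule fg)
    then show False using D1 D2 by (metis less_Suc_eq_le max.cobounded1 max.cobounded2)
  qed
qed

text \<open>Arguments are lifted to the free algebra. Every Laurent representation sends the value
  there to a standard polynomial in matrices, hence to 0, and an element killed by all of them lies
  in the ideal.\<close>

lemma monic_identity_standard_poly: "monic_identity A (standard_poly (2 * l))"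
  unfolding monic_identity_def
proof (intro conjI allI impI)
  show "nc_monic (standard_poly (2 * l))" by (rule nc_monic_standard_poly)
  fix r :: "nat \<Rightarrow> (xyz, 'k) free_algebra set" assume "\<forall>i. r i \<in> carrier A"
  then have "\<exists>f. r i = proj f" for i using proj_surj by metis
  then obtain f where f: "\<And>i. r i = proj (f i)" by metis
  have car: "f i \<in> carrier ring_of_type_algebra" for i
    by (simp only: ring_of_type_algebra_simps UNIV_I)
  let ?e = "nc_eval ring_of_type_algebra f (standard_poly (2 * l))"
  have "?e \<in> I"
  proof (rule in_ideal_if_reps_vanish)
    fix D :: nat assume "D > 0"
    then interpret weyl_laurent q \<alpha> \<beta> \<gamma> l D by (rule weyl_laurent)
    interpret h: ring_hom_ring ring_of_type_algebra "ring_mat TYPE('k fls) l ()" laurent_rep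
      by (rule laurent_rep_ring_hom_ring)
    show "laurent_rep ?e = 0\<^sub>m l l"
      unfolding h.hom_nc_eval[OF car]
      by (rule standard_poly_vanishes_on_matrices) (simp add: laurent_rep_def)
  qed
  then have "proj ?e = \<zero>\<^bsub>A\<^esub>" by (simp only: proj_eq_0_iff)
  moreover have "r = (\<lambda>i. proj (f i))" using f by blast
  then have "proj ?e = nc_eval A r (standard_poly (2 * l))"
    by (simp only: proj.hom_nc_eval[OF car])
  ultimately show "nc_eval A r (standard_poly (2 * l)) = \<zero>\<^bsub>A\<^esub>" by simp
qed

lemma monic_identity_degree_ge:
  assumes f: "monic_identity A f"
  shows "2 * l \<le> nc_degree f"
proof (rule matrix_identity_degree_ge[where 'a = 'k])
  show "nc_monic f" using f by (simp add: monic_identity_def)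
  fix r :: "nat \<Rightarrow> 'k mat" assume r: "\<And>k. r k \<in> carrier_mat l l"
  \<comment> \<open>Any parameters with u and v nonzero would do here; with the identity as scalar
    map the representation is onto, so each matrix argument lifts to the free algebra.\<close>
  interpret weyl_rep id q \<alpha> \<beta> \<gamma> l 1 1 0
    using q root l by unfold_locales auto
  have "\<exists>g. rep g = r k" for k
    using rep_surj[OF _ r[of k]] by (metis surj_id)
  then obtain g where g: "\<And>k. rep (g k) = r k" by metis
  have car: "g k \<in> carrier ring_of_type_algebra" for k
    by (simp only: ring_of_type_algebra_simps UNIV_I)
  interpret h: ring_hom_ring ring_of_type_algebra "ring_mat TYPE('k) l ()" rep
    by (rule rep_ring_hom_ring)
  have "nc_eval A (\<lambda>k. proj (g k)) f = \<zero>\<^bsub>A\<^esub>"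
    using f proj.hom_closed[OF car] by (auto simp: monic_identity_def)
  then have "nc_eval ring_of_type_algebra g f \<in> I"
    by (simp only: proj.hom_nc_eval[OF car, symmetric] proj_eq_0_iff)
  then have "rep (nc_eval ring_of_type_algebra g f) = 0\<^sub>m l l" by (rule rep_eq_0)
  then show "nc_eval (ring_mat TYPE('k) l ()) r f = 0\<^sub>m l l"
    by (simp only: h.hom_nc_eval[OF car] g)
qed

lemma minimal_degree_A: "minimal_degree A = 2 * l"
  unfolding minimal_degree_def
proof (rule Least_equality)
  show "\<exists>f. monic_identity A f \<and> nc_degree f = 2 * l"
    using monic_identity_standard_poly nc_degree_standard_poly by blast
qed (use monic_identity_degree_ge in blast)

end

theorem theorem3p8:
  fixes q \<alpha> \<beta> \<gamma> :: "'k::alg_closed_field" and l :: nat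
  assumes "q \<noteq> 0"
    and "primitive_root_of_unity l (q\<^sup>2)"
    and "l > 1"
  shows "prime_ring (cyclic_weyl_algebra q \<alpha> \<beta> \<gamma>) \<and>
    PI_ring (cyclic_weyl_algebra q \<alpha> \<beta> \<gamma>) \<and>
    PI_degree (cyclic_weyl_algebra q \<alpha> \<beta> \<gamma>) = of_nat l"
proof -
  interpret weyl_quotient q \<alpha> \<beta> \<gamma> l using assms by unfold_locales
  show ?thesis
    using prime_ring_A monic_identity_standard_poly proj.S.ring_axioms
    by (auto simp: PI_ring_def PI_degree_def minimal_degree_A)
qed

end
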